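(* Let $M$ and $N$ be objects of an abelian category $\mathcal{A}$. The following hold both with all words in parentheses omitted and with all of them included. (1) Assume that $\mathcal{A}$ is AB3*. If $N$ is (strongly) $M$-CS-Baer and $\mathcal{E}$-$M$-$\mathcal{K}$-cononsingular, then $M$ is (strongly) extending. (2) Assume that $\mathcal{A}$ is AB3. If $N$ is dual (strongly) $M$-CS-Baer and $M$ is $\mathcal{L}$-$N$-$\mathcal{T}$-cononsingular, then $N$ is (strongly) lifting.
   Context: An abelian category is AB3 (AB3* ) if it has arbitrary coproducts (products); it then has arbitrary sums (intersections) of families of subobjects. A subobject $i:K\to M$ is fully invariant if for every $h:M\to M$ one has $hi=i\alpha$ for some $\alpha:K\to K$. For subobjects $X\subseteq Y$ of an object $N$, $Y$ lies above $X$ if $Y/X$ is superfluous in $N/X$ (a subobject $A$ of $B$ is superfluous if $A+C=B$ implies $C=B$ for every subobject $C$ of $B$). In an AB3* abelian category, $N$ is (strongly) $M$-CS-Baer if for every family $(f_i)_{i\in I}$ of morphisms $f_i:M\to N$, $\bigcap_{i\in I}\mathrm{Ker}(f_i)$ is essential in a (fully invariant) direct summand of $M$. In an AB3 abelian category, $N$ is dual (strongly) $M$-CS-Baer if for every family $(f_i)_{i\in I}$ of morphisms $f_i:M\to N$, $\sum_{i\in I}\mathrm{Im}(f_i)$ lies above a (fully invariant) direct summand of $N$. An object $M$ is (strongly) extending if every subobject of $M$ is essential in a (fully invariant) direct summand of $M$, and (strongly) lifting if every subobject of $M$ lies above a (fully invariant) direct summand of $M$. Let $U=\mathrm{Hom}_{\mathcal{A}}(M,N)$.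 For a subobject $X$ of $M$ put $l_U(X)=\{f\in U\mid X\subseteq\mathrm{Ker}(f)\}$; for a subobject $Y$ of $N$ put $l'_U(Y)=\{f\in U\mid \mathrm{Im}(f)\subseteq Y\}$. $N$ is $\mathcal{E}$-$M$-$\mathcal{K}$-cononsingular if for any subobjects $X\subseteq Y$ of $M$, $l_U(X)=l_U(Y)$ implies that $X$ is essential in $Y$. $M$ is $\mathcal{L}$-$N$-$\mathcal{T}$-cononsingular if for any subobjects $X\subseteq Y$ of $N$, $l'_U(X)=l'_U(Y)$ implies that $Y$ lies above $X$. *)

theory Defs
  imports "HOL-Algebra.Group"
begin

unbundle cardinal_syntax

section \<open>Categories with additive structure\<close>

text \<open>
  A category is given by sets of objects and arrows; \<open>Add\<close> and \<open>Zero\<close> carry the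
  abelian group structure of the Hom-sets. Nothing is assumed about values outside these sets.
  \<open>g \<cdot> f\<close> means first \<open>f\<close>, then \<open>g\<close>.
\<close>

record ('o, 'm) precat =
  Obj :: "'o set"
  Arr :: "'m set"
  Dom :: "'m \<Rightarrow> 'o"
  Cod :: "'m \<Rightarrow> 'o"
  Comp :: "'m \<Rightarrow> 'm \<Rightarrow> 'm"  (infixl "\<cdot>\<index>" 70)
  Ident :: "'o \<Rightarrow> 'm"
  Add :: "'m \<Rightarrow> 'm \<Rightarrow> 'm"
  Zero :: "'o \<Rightarrow> 'o \<Rightarrow> 'm"

definition Hom :: "('o, 'm) precat \<Rightarrow> 'o \<Rightarrow> 'o \<Rightarrow> 'm set" where
  "Hom C A B = {f \<in> Arr C. Dom C f = A \<and> Cod C f = B}"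

definition Hom_group :: "('o, 'm) precat \<Rightarrow> 'o \<Rightarrow> 'o \<Rightarrow> 'm monoid" where
  "Hom_group C A B = \<lparr>carrier = Hom C A B, mult = Add C, one = Zero C A B\<rparr>"

locale category =
  fixes C :: "('o, 'm) precat" (structure)
  assumes Dom_Obj: "f \<in> Arr C \<Longrightarrow> Dom C f \<in> Obj C"
    and Cod_Obj: "f \<in> Arr C \<Longrightarrow> Cod C f \<in> Obj C"
    and Ident_Hom: "A \<in> Obj C \<Longrightarrow> Ident C A \<in> Hom C A A"
    and Comp_Hom: "f \<in> Hom C A B \<Longrightarrow> g \<in> Hom C B D \<Longrightarrow> g \<cdot> f \<in> Hom C A D"
    and Comp_Ident: "f \<in> Hom C A B \<Longrightarrow> f \<cdot> Ident C A = f"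
    and Ident_Comp: "f \<in> Hom C A B \<Longrightarrow> Ident C B \<cdot> f = f"
    and Comp_assoc: "f \<in> Hom C A B \<Longrightarrow> g \<in> Hom C B D \<Longrightarrow> h \<in> Hom C D E \<Longrightarrow>
      (h \<cdot> g) \<cdot> f = h \<cdot> (g \<cdot> f)"

locale preadditive_category = category +
  assumes Hom_comm_group: "A \<in> Obj C \<Longrightarrow> B \<in> Obj C \<Longrightarrow> comm_group (Hom_group C A B)"
    and Comp_Add: "f \<in> Hom C A B \<Longrightarrow> g \<in> Hom C A B \<Longrightarrow> h \<in> Hom C B D \<Longrightarrow>
      h \<cdot> Add C f g = Add C (h \<cdot> f) (h \<cdot> g)"
    and Add_Comp: "f \<in> Hom C A B \<Longrightarrow> g \<in> Hom C B D \<Longrightarrow> h \<in> Hom C B D \<Longrightarrow>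
      Add C g h \<cdot> f = Add C (g \<cdot> f) (h \<cdot> f)"

definition mono_arr :: "('o, 'm) precat \<Rightarrow> 'm \<Rightarrow> bool" where
  "mono_arr C f \<longleftrightarrow> f \<in> Arr C \<and>
    (\<forall>X\<in>Obj C. \<forall>g\<in>Hom C X (Dom C f). \<forall>h\<in>Hom C X (Dom C f).
      f \<cdot>\<^bsub>C\<^esub> g = f \<cdot>\<^bsub>C\<^esub> h \<longrightarrow> g = h)"

definition epi_arr :: "('o, 'm) precat \<Rightarrow> 'm \<Rightarrow> bool" where
  "epi_arr C f \<longleftrightarrow> f \<in> Arr C \<and>
    (\<forall>X\<in>Obj C. \<forall>g\<in>Hom C (Cod C f) X. \<forall>h\<in>Hom C (Cod C f) X.
      g \<cdot>\<^bsub>C\<^esub> f = h \<cdot>\<^bsub>C\<^esub> f \<longrightarrow> g = h)"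

definition zero_object :: "('o, 'm) precat \<Rightarrow> 'o \<Rightarrow> bool" where
  "zero_object C Z \<longleftrightarrow> Z \<in> Obj C \<and>
    (\<forall>A\<in>Obj C. (\<exists>!f. f \<in> Hom C Z A) \<and> (\<exists>!f. f \<in> Hom C A Z))"

definition is_kernel :: "('o, 'm) precat \<Rightarrow> 'm \<Rightarrow> 'm \<Rightarrow> bool" where
  "is_kernel C f k \<longleftrightarrow> f \<in> Arr C \<and> k \<in> Arr C \<and> Cod C k = Dom C f \<and>
    f \<cdot>\<^bsub>C\<^esub> k = Zero C (Dom C k) (Cod C f) \<and>
    (\<forall>X\<in>Obj C. \<forall>g\<in>Hom C X (Dom C f). f \<cdot>\<^bsub>C\<^esub> g = Zero C X (Cod C f) \<longrightarrow>
      (\<exists>!h. h \<in> Hom C X (Dom C k) \<and> k \<cdot>\<^bsub>C\<^esub> h = g))"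

definition is_cokernel :: "('o, 'm) precat \<Rightarrow> 'm \<Rightarrow> 'm \<Rightarrow> bool" where
  "is_cokernel C f q \<longleftrightarrow> f \<in> Arr C \<and> q \<in> Arr C \<and> Dom C q = Cod C f \<and>
    q \<cdot>\<^bsub>C\<^esub> f = Zero C (Dom C f) (Cod C q) \<and>
    (\<forall>X\<in>Obj C. \<forall>g\<in>Hom C (Cod C f) X. g \<cdot>\<^bsub>C\<^esub> f = Zero C (Dom C f) X \<longrightarrow>
      (\<exists>!h. h \<in> Hom C (Cod C q) X \<and> h \<cdot>\<^bsub>C\<^esub> q = g))"

definition is_biproduct ::
    "('o, 'm) precat \<Rightarrow> 'o \<Rightarrow> 'o \<Rightarrow> 'o \<Rightarrow> 'm \<Rightarrow> 'm \<Rightarrow> 'm \<Rightarrow> 'm \<Rightarrow> bool" where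
  "is_biproduct C A B P i j p q \<longleftrightarrow>
    i \<in> Hom C A P \<and> j \<in> Hom C B P \<and> p \<in> Hom C P A \<and> q \<in> Hom C P B \<and>
    p \<cdot>\<^bsub>C\<^esub> i = Ident C A \<and> q \<cdot>\<^bsub>C\<^esub> j = Ident C B \<and>
    p \<cdot>\<^bsub>C\<^esub> j = Zero C B A \<and> q \<cdot>\<^bsub>C\<^esub> i = Zero C A B \<and>
    Add C (i \<cdot>\<^bsub>C\<^esub> p) (j \<cdot>\<^bsub>C\<^esub> q) = Ident C P"

locale abelian_category = preadditive_category +
  assumes ex_zero_object: "\<exists>Z. zero_object C Z"
    and ex_biproduct: "A \<in> Obj C \<Longrightarrow> B \<in> Obj C \<Longrightarrow> \<exists>P i j p q. P \<in> Obj C \<and> is_biproduct C A B P i j p q"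
    and ex_kernel: "f \<in> Arr C \<Longrightarrow> \<exists>k. is_kernel C f k"
    and ex_cokernel: "f \<in> Arr C \<Longrightarrow> \<exists>q. is_cokernel C f q"
    and mono_normal: "mono_arr C k \<Longrightarrow> \<exists>f. is_kernel C f k"
    and epi_normal: "epi_arr C q \<Longrightarrow> \<exists>f. is_cokernel C f q"


section \<open>Smallness and the conditions AB3, AB3*\<close>

text \<open>
  A category whose objects form a proper class cannot have products indexed by arbitrary sets
  of the type of its arrows (Freyd), so ``set-indexed'' has to be distinguished from
  ``class-sized''. The type \<open>'u\<close> plays the role of a Grothendieck universe: the sets belonging
  to a universe are, up to bijection, exactly those of cardinality strictly less than that of
  the universe. Every index set of a small family is then in bijection with a small set of
  type \<open>'u set\<close>. As usual, Hom-sets are required to be small.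
\<close>

definition small :: "'u itself \<Rightarrow> 'a set \<Rightarrow> bool" where
  "small U S \<longleftrightarrow> |S| <o |UNIV :: 'u set|"

definition locally_small :: "'u itself \<Rightarrow> ('o, 'm) precat \<Rightarrow> bool" where
  "locally_small U C \<longleftrightarrow> (\<forall>A\<in>Obj C. \<forall>B\<in>Obj C. small U (Hom C A B))"

definition is_product ::
    "('o, 'm) precat \<Rightarrow> 'i set \<Rightarrow> ('i \<Rightarrow> 'o) \<Rightarrow> 'o \<Rightarrow> ('i \<Rightarrow> 'm) \<Rightarrow> bool" where
  "is_product C I A P p \<longleftrightarrow> P \<in> Obj C \<and> (\<forall>i\<in>I. p i \<in> Hom C P (A i)) \<and>
    (\<forall>X\<in>Obj C. \<forall>f. (\<forall>i\<in>I. f i \<in> Hom C X (A i)) \<longrightarrow>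
      (\<exists>!h. h \<in> Hom C X P \<and> (\<forall>i\<in>I. p i \<cdot>\<^bsub>C\<^esub> h = f i)))"

definition is_coproduct ::
    "('o, 'm) precat \<Rightarrow> 'i set \<Rightarrow> ('i \<Rightarrow> 'o) \<Rightarrow> 'o \<Rightarrow> ('i \<Rightarrow> 'm) \<Rightarrow> bool" where
  "is_coproduct C I A P j \<longleftrightarrow> P \<in> Obj C \<and> (\<forall>i\<in>I. j i \<in> Hom C (A i) P) \<and>
    (\<forall>X\<in>Obj C. \<forall>f. (\<forall>i\<in>I. f i \<in> Hom C (A i) X) \<longrightarrow>
      (\<exists>!h. h \<in> Hom C P X \<and> (\<forall>i\<in>I. h \<cdot>\<^bsub>C\<^esub> j i = f i)))"

definition AB3 :: "'u itself \<Rightarrow> ('o, 'm) precat \<Rightarrow> bool" where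
  "AB3 U C \<longleftrightarrow> (\<forall>(I :: 'u set) A. small U I \<and> (\<forall>i\<in>I. A i \<in> Obj C) \<longrightarrow>
    (\<exists>P j. is_coproduct C I A P j))"

definition AB3_star :: "'u itself \<Rightarrow> ('o, 'm) precat \<Rightarrow> bool" where
  "AB3_star U C \<longleftrightarrow> (\<forall>(I :: 'u set) A. small U I \<and> (\<forall>i\<in>I. A i \<in> Obj C) \<longrightarrow>
    (\<exists>P p. is_product C I A P p))"


section \<open>Subobjects\<close>

text \<open>
  Subobjects are represented by monomorphisms; equality of subobjects is \<open>sub_eq\<close>, and all
  notions below are invariant under it. \<open>Ker\<close>, \<open>Coker\<close>, \<open>sub_inter\<close> and \<open>sub_sum\<close> choose
  representatives of objects determined up to isomorphism.
\<close>

definition subobject :: "('o, 'm) precat \<Rightarrow> 'o \<Rightarrow> 'm \<Rightarrow> bool" where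
  "subobject C M x \<longleftrightarrow> mono_arr C x \<and> Cod C x = M"

definition sub_le :: "('o, 'm) precat \<Rightarrow> 'm \<Rightarrow> 'm \<Rightarrow> bool" where
  "sub_le C x y \<longleftrightarrow> (\<exists>u \<in> Hom C (Dom C x) (Dom C y). y \<cdot>\<^bsub>C\<^esub> u = x)"

definition sub_eq :: "('o, 'm) precat \<Rightarrow> 'm \<Rightarrow> 'm \<Rightarrow> bool" where
  "sub_eq C x y \<longleftrightarrow> sub_le C x y \<and> sub_le C y x"

definition sub_incl :: "('o, 'm) precat \<Rightarrow> 'm \<Rightarrow> 'm \<Rightarrow> 'm" where
  "sub_incl C x y = (THE u. u \<in> Hom C (Dom C x) (Dom C y) \<and> y \<cdot>\<^bsub>C\<^esub> u = x)"

definition Ker :: "('o, 'm) precat \<Rightarrow> 'm \<Rightarrow> 'm" where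
  "Ker C f = (SOME k. is_kernel C f k)"

definition Coker :: "('o, 'm) precat \<Rightarrow> 'm \<Rightarrow> 'm" where
  "Coker C f = (SOME q. is_cokernel C f q)"

definition Img :: "('o, 'm) precat \<Rightarrow> 'm \<Rightarrow> 'm" where
  "Img C f = Ker C (Coker C f)"

definition is_intersection :: "('o, 'm) precat \<Rightarrow> 'o \<Rightarrow> 'm set \<Rightarrow> 'm \<Rightarrow> bool" where
  "is_intersection C M S k \<longleftrightarrow> subobject C M k \<and> (\<forall>s\<in>S. sub_le C k s) \<and>
    (\<forall>l. subobject C M l \<and> (\<forall>s\<in>S. sub_le C l s) \<longrightarrow> sub_le C l k)"

definition is_sum :: "('o, 'm) precat \<Rightarrow> 'o \<Rightarrow> 'm set \<Rightarrow> 'm \<Rightarrow> bool" where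
  "is_sum C M S k \<longleftrightarrow> subobject C M k \<and> (\<forall>s\<in>S. sub_le C s k) \<and>
    (\<forall>l. subobject C M l \<and> (\<forall>s\<in>S. sub_le C s l) \<longrightarrow> sub_le C k l)"

definition sub_inter :: "('o, 'm) precat \<Rightarrow> 'o \<Rightarrow> 'm set \<Rightarrow> 'm" where
  "sub_inter C M S = (SOME k. is_intersection C M S k)"

definition sub_sum :: "('o, 'm) precat \<Rightarrow> 'o \<Rightarrow> 'm set \<Rightarrow> 'm" where
  "sub_sum C M S = (SOME k. is_sum C M S k)"

definition essential :: "('o, 'm) precat \<Rightarrow> 'm \<Rightarrow> bool" where
  "essential C a \<longleftrightarrow> mono_arr C a \<and>
    (\<forall>c. subobject C (Cod C a) c \<and> zero_object C (Dom C (sub_inter C (Cod C a) {a, c})) \<longrightarrow>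
      zero_object C (Dom C c))"

definition superfluous :: "('o, 'm) precat \<Rightarrow> 'm \<Rightarrow> bool" where
  "superfluous C a \<longleftrightarrow> mono_arr C a \<and>
    (\<forall>c. subobject C (Cod C a) c \<and>
      sub_eq C (sub_sum C (Cod C a) {a, c}) (Ident C (Cod C a)) \<longrightarrow>
      sub_eq C c (Ident C (Cod C a)))"

definition essential_in :: "('o, 'm) precat \<Rightarrow> 'm \<Rightarrow> 'm \<Rightarrow> bool" where
  "essential_in C x y \<longleftrightarrow> sub_le C x y \<and> essential C (sub_incl C x y)"

text \<open>
  For subobjects \<open>x \<le> y\<close> of \<open>N\<close>, represented by \<open>X \<rightarrow> N\<close> and \<open>Y \<rightarrow> N\<close>, this is \<open>Y/X\<close> as a
  subobject of \<open>N/X\<close>, i.e. the morphism \<open>Y/X \<rightarrow> N/X\<close> induced by \<open>y\<close> on cokernels.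
\<close>

definition sub_quotient :: "('o, 'm) precat \<Rightarrow> 'm \<Rightarrow> 'm \<Rightarrow> 'm" where
  "sub_quotient C y x = (let p = Coker C (sub_incl C x y); q = Coker C x in
    THE k. k \<in> Hom C (Cod C p) (Cod C q) \<and> k \<cdot>\<^bsub>C\<^esub> p = q \<cdot>\<^bsub>C\<^esub> y)"

definition lies_above :: "('o, 'm) precat \<Rightarrow> 'm \<Rightarrow> 'm \<Rightarrow> bool" where
  "lies_above C y x \<longleftrightarrow> sub_le C x y \<and> superfluous C (sub_quotient C y x)"

definition direct_summand :: "('o, 'm) precat \<Rightarrow> 'o \<Rightarrow> 'm \<Rightarrow> bool" where
  "direct_summand C M d \<longleftrightarrow> subobject C M d \<and>
    (\<exists>B\<in>Obj C. \<exists>e p q. is_biproduct C (Dom C d) B M d e p q)"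

definition fully_invariant :: "('o, 'm) precat \<Rightarrow> 'o \<Rightarrow> 'm \<Rightarrow> bool" where
  "fully_invariant C M i \<longleftrightarrow> subobject C M i \<and>
    (\<forall>h\<in>Hom C M M. \<exists>a\<in>Hom C (Dom C i) (Dom C i). h \<cdot>\<^bsub>C\<^esub> i = i \<cdot>\<^bsub>C\<^esub> a)"


section \<open>CS-Baer, extending, lifting and cononsingular objects\<close>

text \<open>\<open>CS_Baer U C M N\<close> reads ``\<open>N\<close> is \<open>M\<close>-CS-Baer'', and similarly for the dual and strong notions.\<close>

definition CS_Baer :: "'u itself \<Rightarrow> ('o, 'm) precat \<Rightarrow> 'o \<Rightarrow> 'o \<Rightarrow> bool" where
  "CS_Baer U C M N \<longleftrightarrow> (\<forall>(I :: 'u set) f. small U I \<and> (\<forall>i\<in>I. f i \<in> Hom C M N) \<longrightarrow>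
    (\<exists>d. direct_summand C M d \<and>
      essential_in C (sub_inter C M ((\<lambda>i. Ker C (f i)) ` I)) d))"

definition strongly_CS_Baer :: "'u itself \<Rightarrow> ('o, 'm) precat \<Rightarrow> 'o \<Rightarrow> 'o \<Rightarrow> bool" where
  "strongly_CS_Baer U C M N \<longleftrightarrow> (\<forall>(I :: 'u set) f. small U I \<and> (\<forall>i\<in>I. f i \<in> Hom C M N) \<longrightarrow>
    (\<exists>d. direct_summand C M d \<and> fully_invariant C M d \<and>
      essential_in C (sub_inter C M ((\<lambda>i. Ker C (f i)) ` I)) d))"

definition dual_CS_Baer :: "'u itself \<Rightarrow> ('o, 'm) precat \<Rightarrow> 'o \<Rightarrow> 'o \<Rightarrow> bool" where
  "dual_CS_Baer U C M N \<longleftrightarrow> (\<forall>(I :: 'u set) f. small U I \<and> (\<forall>i\<in>I. f i \<in> Hom C M N) \<longrightarrow>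
    (\<exists>d. direct_summand C N d \<and>
      lies_above C (sub_sum C N ((\<lambda>i. Img C (f i)) ` I)) d))"

definition dual_strongly_CS_Baer :: "'u itself \<Rightarrow> ('o, 'm) precat \<Rightarrow> 'o \<Rightarrow> 'o \<Rightarrow> bool" where
  "dual_strongly_CS_Baer U C M N \<longleftrightarrow> (\<forall>(I :: 'u set) f. small U I \<and> (\<forall>i\<in>I. f i \<in> Hom C M N) \<longrightarrow>
    (\<exists>d. direct_summand C N d \<and> fully_invariant C N d \<and>
      lies_above C (sub_sum C N ((\<lambda>i. Img C (f i)) ` I)) d))"

definition extending :: "('o, 'm) precat \<Rightarrow> 'o \<Rightarrow> bool" where
  "extending C M \<longleftrightarrow> (\<forall>x. subobject C M x \<longrightarrow>
    (\<exists>d. direct_summand C M d \<and> essential_in C x d))"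

definition strongly_extending :: "('o, 'm) precat \<Rightarrow> 'o \<Rightarrow> bool" where
  "strongly_extending C M \<longleftrightarrow> (\<forall>x. subobject C M x \<longrightarrow>
    (\<exists>d. direct_summand C M d \<and> fully_invariant C M d \<and> essential_in C x d))"

definition lifting :: "('o, 'm) precat \<Rightarrow> 'o \<Rightarrow> bool" where
  "lifting C M \<longleftrightarrow> (\<forall>x. subobject C M x \<longrightarrow>
    (\<exists>d. direct_summand C M d \<and> lies_above C x d))"

definition strongly_lifting :: "('o, 'm) precat \<Rightarrow> 'o \<Rightarrow> bool" where
  "strongly_lifting C M \<longleftrightarrow> (\<forall>x. subobject C M x \<longrightarrow>
    (\<exists>d. direct_summand C M d \<and> fully_invariant C M d \<and> lies_above C x d))"

definition l_ann :: "('o, 'm) precat \<Rightarrow> 'o \<Rightarrow> 'o \<Rightarrow> 'm \<Rightarrow> 'm set" where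
  "l_ann C M N x = {f \<in> Hom C M N. sub_le C x (Ker C f)}"

definition l_ann' :: "('o, 'm) precat \<Rightarrow> 'o \<Rightarrow> 'o \<Rightarrow> 'm \<Rightarrow> 'm set" where
  "l_ann' C M N y = {f \<in> Hom C M N. sub_le C (Img C f) y}"

text \<open>``\<open>N\<close> is \<open>\<E>\<close>-\<open>M\<close>-\<open>\<K>\<close>-cononsingular'', respectively ``\<open>M\<close> is \<open>\<L>\<close>-\<open>N\<close>-\<open>\<T>\<close>-cononsingular''.\<close>

definition EK_cononsingular :: "('o, 'm) precat \<Rightarrow> 'o \<Rightarrow> 'o \<Rightarrow> bool" where
  "EK_cononsingular C M N \<longleftrightarrow> (\<forall>x y. subobject C M x \<and> subobject C M y \<and> sub_le C x y \<and>
    l_ann C M N x = l_ann C M N y \<longrightarrow> essential_in C x y)"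

definition LT_cononsingular :: "('o, 'm) precat \<Rightarrow> 'o \<Rightarrow> 'o \<Rightarrow> bool" where
  "LT_cononsingular C M N \<longleftrightarrow> (\<forall>x y. subobject C N x \<and> subobject C N y \<and> sub_le C x y \<and>
    l_ann' C M N x = l_ann' C M N y \<longrightarrow> lies_above C y x)"

end

(* For (1), the intersection K of the kernels of all f in l_U(X) contains X and has the same
   annihilator as X, so X is essential in K by cononsingularity and K is essential in a summand by
   the CS-Baer property; essentiality is transitive. Dually for (2), with the sum of the images of
   all f in l'_U(Y). Transitivity of "lies above" is proved through the criterion that Y lies above
   X iff every epimorphism r with r X = 0 whose restriction to Y is epi vanishes. *)

theory Submission
  imports Defs
begin

text \<open>Containment of subobjects is handled as an equation: every subobject is the kernel of
  some morphism \<open>g\<close>, and \<open>X\<close> is contained in it exactly when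
  \<open>g\<close> annihilates \<open>X\<close>. Images and sums are then determined by the
  morphisms that annihilate them. \<open>sub_inter\<close> and \<open>sub_sum\<close> are choices
  and say nothing until an intersection or a sum is known to exist. For two subobjects this is
  finite abelian category theory; for a family, the intersection of kernels is the kernel of the
  induced morphism into a power of \<open>N\<close>, and the sum of images is the image of the
  induced morphism out of a copower of \<open>M\<close>. This is where AB3* and AB3 enter. The
  families must be small, and annihilators qualify because Hom-sets are small. The two halves are
  dual in outline but not in effort: essentiality composes along inclusions, whereas lying above
  speaks of subobjects of different quotients of \<open>N\<close>. The criterion by epimorphisms
  moves everything to morphisms out of the one object \<open>N\<close>.\<close>

context category
begin

section \<open>Composition, monomorphisms, epimorphisms and the order on subobjects\<close>

lemma Hom_Arr: "f \<in> Hom C A B \<Longrightarrow> f \<in> Arr C"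
  and Hom_Dom: "f \<in> Hom C A B \<Longrightarrow> Dom C f = A"
  and Hom_Cod: "f \<in> Hom C A B \<Longrightarrow> Cod C f = B"
  and Arr_Hom: "f \<in> Arr C \<Longrightarrow> f \<in> Hom C (Dom C f) (Cod C f)"
  by (auto simp: Hom_def)

lemma Hom_Obj_Dom: "f \<in> Hom C A B \<Longrightarrow> A \<in> Obj C"
  and Hom_Obj_Cod: "f \<in> Hom C A B \<Longrightarrow> B \<in> Obj C"
  using Dom_Obj Cod_Obj by (auto simp: Hom_def)

lemma mono_cancel:
  assumes "mono_arr C f" "f \<in> Hom C A B" "g \<in> Hom C X A" "h \<in> Hom C X A" "f \<cdot> g = f \<cdot> h"
  shows "g = h"
  using assms Hom_Obj_Dom[OF assms(3)] Hom_Dom[OF assms(2)] unfolding mono_arr_def by blast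

lemma epi_cancel:
  assumes "epi_arr C f" "f \<in> Hom C A B" "g \<in> Hom C B X" "h \<in> Hom C B X" "g \<cdot> f = h \<cdot> f"
  shows "g = h"
  using assms Hom_Obj_Cod[OF assms(3)] Hom_Cod[OF assms(2)] unfolding epi_arr_def by blast

lemma subobject_Hom: "subobject C M x \<Longrightarrow> x \<in> Hom C (Dom C x) M"
  by (auto simp: subobject_def mono_arr_def Hom_def)

lemma subobject_Ident:
  assumes "M \<in> Obj C"
  shows "subobject C M (Ident C M)"
  using Ident_Hom[OF assms] Hom_Cod[OF Ident_Hom[OF assms]] Hom_Dom[OF Ident_Hom[OF assms]]
  unfolding subobject_def mono_arr_def by (auto simp: Hom_Arr Ident_Comp)

lemma sub_le_Ident: "subobject C M x \<Longrightarrow> sub_le C x (Ident C M)"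
  using subobject_Hom[of M x] Hom_Obj_Cod[OF subobject_Hom[of M x]]
  unfolding sub_le_def by (metis Ident_Comp Ident_Hom Hom_Dom)

lemma sub_le_trans:
  assumes "sub_le C x y" "sub_le C y z" "z \<in> Arr C"
  shows "sub_le C x z"
proof -
  obtain u v where u: "u \<in> Hom C (Dom C x) (Dom C y)" "y \<cdot> u = x"
    and v: "v \<in> Hom C (Dom C y) (Dom C z)" "z \<cdot> v = y"
    using assms unfolding sub_le_def by blast
  have "z \<cdot> (v \<cdot> u) = x"
    using Comp_assoc[OF u(1) v(1) Arr_Hom[OF assms(3)]] u v by simp
  with Comp_Hom[OF u(1) v(1)] show ?thesis unfolding sub_le_def by blast
qed

text \<open>Existence of the factorization is \<open>sub_le\<close>, uniqueness is monicity of
  \<open>y\<close>; both are needed for the definite description in \<open>sub_incl\<close> to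
  denote.\<close>

lemma sub_incl:
  assumes "sub_le C x y" "subobject C M y"
  shows "sub_incl C x y \<in> Hom C (Dom C x) (Dom C y)" "y \<cdot> sub_incl C x y = x"
proof -
  have "\<exists>!u. u \<in> Hom C (Dom C x) (Dom C y) \<and> y \<cdot> u = x"
    using assms mono_cancel[OF _ subobject_Hom[OF assms(2)]]
    unfolding sub_le_def subobject_def by metis
  from theI'[OF this] show "sub_incl C x y \<in> Hom C (Dom C x) (Dom C y)" "y \<cdot> sub_incl C x y = x"
    unfolding sub_incl_def by blast+
qed

lemma mono_Comp:
  assumes "mono_arr C f" "mono_arr C g" "f \<in> Hom C A B" "g \<in> Hom C B D"
  shows "mono_arr C (g \<cdot> f)"
proof -
  have gf: "g \<cdot> f \<in> Hom C A D" by (rule Comp_Hom[OF assms(3,4)])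
  have "s = t" if st: "s \<in> Hom C X A" "t \<in> Hom C X A" "(g \<cdot> f) \<cdot> s = (g \<cdot> f) \<cdot> t" for X s t
  proof -
    have "g \<cdot> (f \<cdot> s) = g \<cdot> (f \<cdot> t)"
      using st(3) Comp_assoc[OF st(1) assms(3,4)] Comp_assoc[OF st(2) assms(3,4)] by simp
    then have "f \<cdot> s = f \<cdot> t"
      by (rule mono_cancel[OF assms(2,4) Comp_Hom[OF st(1) assms(3)] Comp_Hom[OF st(2) assms(3)]])
    then show ?thesis by (rule mono_cancel[OF assms(1,3) st(1,2)])
  qed
  then show ?thesis using gf unfolding mono_arr_def by (metis Hom_Arr Hom_Dom)
qed

lemma mono_factor:
  assumes "mono_arr C (g \<cdot> f)" "f \<in> Hom C A B" "g \<in> Hom C B D"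
  shows "mono_arr C f"
proof -
  have gf: "g \<cdot> f \<in> Hom C A D" by (rule Comp_Hom[OF assms(2,3)])
  have "s = t" if "s \<in> Hom C X A" "t \<in> Hom C X A" "f \<cdot> s = f \<cdot> t" for X s t
    by (rule mono_cancel[OF assms(1) gf that(1,2)])
      (simp add: that(3) Comp_assoc[OF that(1) assms(2,3)] Comp_assoc[OF that(2) assms(2,3)])
  then show ?thesis using assms(2) unfolding mono_arr_def by (metis Hom_Arr Hom_Dom)
qed

lemma epi_Comp:
  assumes "epi_arr C f" "epi_arr C g" "f \<in> Hom C A B" "g \<in> Hom C B D"
  shows "epi_arr C (g \<cdot> f)"
proof -
  have gf: "g \<cdot> f \<in> Hom C A D" by (rule Comp_Hom[OF assms(3,4)])
  have "s = t" if st: "s \<in> Hom C D X" "t \<in> Hom C D X" "s \<cdot> (g \<cdot> f) = t \<cdot> (g \<cdot> f)" for X s t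
  proof -
    have "(s \<cdot> g) \<cdot> f = (t \<cdot> g) \<cdot> f"
      using st(3) Comp_assoc[OF assms(3,4) st(1)] Comp_assoc[OF assms(3,4) st(2)] by simp
    then have "s \<cdot> g = t \<cdot> g"
      by (rule epi_cancel[OF assms(1,3) Comp_Hom[OF assms(4) st(1)] Comp_Hom[OF assms(4) st(2)]])
    then show ?thesis by (rule epi_cancel[OF assms(2,4) st(1,2)])
  qed
  then show ?thesis using gf unfolding epi_arr_def by (metis Hom_Arr Hom_Cod)
qed

lemma epi_factor:
  assumes "epi_arr C (g \<cdot> f)" "f \<in> Hom C A B" "g \<in> Hom C B D"
  shows "epi_arr C g"
proof -
  have gf: "g \<cdot> f \<in> Hom C A D" by (rule Comp_Hom[OF assms(2,3)])
  have "s = t" if "s \<in> Hom C D X" "t \<in> Hom C D X" "s \<cdot> g = t \<cdot> g" for X s t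
    by (rule epi_cancel[OF assms(1) gf that(1,2)])
      (metis that(3) Comp_assoc[OF assms(2,3) that(1)] Comp_assoc[OF assms(2,3) that(2)])
  then show ?thesis using assms(3) unfolding epi_arr_def by (metis Hom_Arr Hom_Cod)
qed

lemma subobject_of_le:
  assumes "subobject C M x" "subobject C M y" "sub_le C x y"
  shows "subobject C (Dom C y) (sub_incl C x y)"
proof -
  note u = sub_incl[OF assms(3,2)]
  have "mono_arr C (sub_incl C x y)"
    by (rule mono_factor[OF _ u(1) subobject_Hom[OF assms(2)]])
      (use assms(1) u(2) in \<open>simp add: subobject_def\<close>)
  with u(1) show ?thesis by (simp add: subobject_def Hom_Cod)
qed

end

section \<open>Zero morphisms, zero objects and tests by annihilation\<close>

context preadditive_category
begin

lemma Zero_Hom: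
  assumes "A \<in> Obj C" "B \<in> Obj C"
  shows "Zero C A B \<in> Hom C A B"
proof -
  interpret G: comm_group "Hom_group C A B" by (rule Hom_comm_group[OF assms])
  show ?thesis using G.one_closed by (simp add: Hom_group_def)
qed

lemma Add_Hom:
  assumes "a \<in> Hom C A B" "b \<in> Hom C A B"
  shows "Add C a b \<in> Hom C A B"
proof -
  interpret G: comm_group "Hom_group C A B"
    by (rule Hom_comm_group[OF Hom_Obj_Dom[OF assms(1)] Hom_Obj_Cod[OF assms(1)]])
  show ?thesis using G.m_closed[of a b] assms by (simp add: Hom_group_def)
qed

lemma Zero_Add:
  assumes "b \<in> Hom C A B"
  shows "Add C (Zero C A B) b = b"
proof -
  interpret G: comm_group "Hom_group C A B"
    by (rule Hom_comm_group[OF Hom_Obj_Dom[OF assms(1)] Hom_Obj_Cod[OF assms(1)]])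
  show ?thesis using G.l_one[of b] assms by (simp add: Hom_group_def)
qed

lemma Add_eq_right:
  assumes "a \<in> Hom C A B" "b \<in> Hom C A B" "Add C a b = b"
  shows "a = Zero C A B"
proof -
  interpret G: comm_group "Hom_group C A B"
    by (rule Hom_comm_group[OF Hom_Obj_Dom[OF assms(1)] Hom_Obj_Cod[OF assms(1)]])
  show ?thesis using G.r_cancel_one[of b a] assms by (simp add: Hom_group_def)
qed

text \<open>The record carries no negation, so this \<open>d\<close> stands in for
  \<open>a - b\<close>. It lets \<open>mono_iff\<close> and \<open>epi_iff\<close> reduce
  cancellation to a test on zero.\<close>

lemma ex_difference:
  assumes "a \<in> Hom C A B" "b \<in> Hom C A B"
  shows "\<exists>d\<in>Hom C A B. Add C d b = a"
proof -
  interpret G: comm_group "Hom_group C A B"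
    by (rule Hom_comm_group[OF Hom_Obj_Dom[OF assms(1)] Hom_Obj_Cod[OF assms(1)]])
  have ab: "a \<in> carrier (Hom_group C A B)" "b \<in> carrier (Hom_group C A B)"
    using assms by (simp_all add: Hom_group_def)
  let ?d = "a \<otimes>\<^bsub>Hom_group C A B\<^esub> inv\<^bsub>Hom_group C A B\<^esub> b"
  have "?d \<in> carrier (Hom_group C A B)" "?d \<otimes>\<^bsub>Hom_group C A B\<^esub> b = a"
    using ab by (simp_all add: G.m_assoc)
  then show ?thesis by (auto simp: Hom_group_def)
qed

text \<open>By distributivity \<open>f \<cdot> Zero C A B\<close> added to itself is unchanged, and
  cancellation in the Hom-group leaves zero.\<close>

lemma Comp_Zero:
  assumes "A \<in> Obj C" "f \<in> Hom C B D"
  shows "f \<cdot> Zero C A B = Zero C A D"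
proof -
  note z = Zero_Hom[OF assms(1) Hom_Obj_Dom[OF assms(2)]]
  have "Add C (f \<cdot> Zero C A B) (f \<cdot> Zero C A B) = f \<cdot> Zero C A B"
    using Comp_Add[OF z z assms(2)] Zero_Add[OF z] by simp
  then show ?thesis using Add_eq_right Comp_Hom[OF z assms(2)] by blast
qed

lemma Zero_Comp:
  assumes "D \<in> Obj C" "f \<in> Hom C A B"
  shows "Zero C B D \<cdot> f = Zero C A D"
proof -
  note z = Zero_Hom[OF Hom_Obj_Cod[OF assms(2)] assms(1)]
  have "Add C (Zero C B D \<cdot> f) (Zero C B D \<cdot> f) = Zero C B D \<cdot> f"
    using Add_Comp[OF assms(2) z z] Zero_Add[OF z] by simp
  then show ?thesis using Add_eq_right Comp_Hom[OF assms(2) z] by blast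
qed

lemma mono_iff:
  assumes f: "f \<in> Hom C A B"
  shows "mono_arr C f \<longleftrightarrow> (\<forall>X. \<forall>t\<in>Hom C X A. f \<cdot> t = Zero C X B \<longrightarrow> t = Zero C X A)"
    (is "_ \<longleftrightarrow> ?R")
proof
  assume m: "mono_arr C f"
  show ?R
  proof (intro allI ballI impI)
    fix X t assume t: "t \<in> Hom C X A" "f \<cdot> t = Zero C X B"
    note z = Zero_Hom[OF Hom_Obj_Dom[OF t(1)] Hom_Obj_Dom[OF f]]
    show "t = Zero C X A"
      by (rule mono_cancel[OF m f t(1) z]) (simp add: t(2) Comp_Zero[OF Hom_Obj_Dom[OF t(1)] f])
  qed
next
  assume R: ?R
  have "s = t" if st: "s \<in> Hom C X A" "t \<in> Hom C X A" "f \<cdot> s = f \<cdot> t" for X s t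
  proof -
    obtain d where d: "d \<in> Hom C X A" "Add C d t = s" using ex_difference[OF st(1,2)] by blast
    have "Add C (f \<cdot> d) (f \<cdot> t) = f \<cdot> t" using Comp_Add[OF d(1) st(2) f] d(2) st(3) by simp
    then have "f \<cdot> d = Zero C X B" using Add_eq_right Comp_Hom[OF d(1) f] Comp_Hom[OF st(2) f] by blast
    then have "d = Zero C X A" using R d(1) by blast
    then show ?thesis using d(2) Zero_Add[OF st(2)] by simp
  qed
  then show "mono_arr C f" using f unfolding mono_arr_def by (metis Hom_Arr Hom_Dom)
qed

lemma epi_iff:
  assumes f: "f \<in> Hom C A B"
  shows "epi_arr C f \<longleftrightarrow> (\<forall>X. \<forall>t\<in>Hom C B X. t \<cdot> f = Zero C A X \<longrightarrow> t = Zero C B X)"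
    (is "_ \<longleftrightarrow> ?R")
proof
  assume m: "epi_arr C f"
  show ?R
  proof (intro allI ballI impI)
    fix X t assume t: "t \<in> Hom C B X" "t \<cdot> f = Zero C A X"
    note z = Zero_Hom[OF Hom_Obj_Cod[OF f] Hom_Obj_Cod[OF t(1)]]
    show "t = Zero C B X"
      by (rule epi_cancel[OF m f t(1) z]) (simp add: t(2) Zero_Comp[OF Hom_Obj_Cod[OF t(1)] f])
  qed
next
  assume R: ?R
  have "s = t" if st: "s \<in> Hom C B X" "t \<in> Hom C B X" "s \<cdot> f = t \<cdot> f" for X s t
  proof -
    obtain d where d: "d \<in> Hom C B X" "Add C d t = s" using ex_difference[OF st(1,2)] by blast
    have "Add C (d \<cdot> f) (t \<cdot> f) = t \<cdot> f" using Add_Comp[OF f d(1) st(2)] d(2) st(3) by simp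
    then have "d \<cdot> f = Zero C A X" using Add_eq_right Comp_Hom[OF f d(1)] Comp_Hom[OF f st(2)] by blast
    then have "d = Zero C B X" using R d(1) by blast
    then show ?thesis using d(2) Zero_Add[OF st(2)] by simp
  qed
  then show "epi_arr C f" using f unfolding epi_arr_def by (metis Hom_Arr Hom_Cod)
qed

lemma zero_object_iff:
  assumes "A \<in> Obj C"
  shows "zero_object C A \<longleftrightarrow> Ident C A = Zero C A A"
proof
  assume "zero_object C A"
  then show "Ident C A = Zero C A A"
    using assms Ident_Hom[OF assms] Zero_Hom[OF assms assms] unfolding zero_object_def by blast
next
  assume I: "Ident C A = Zero C A A"
  have "f = Zero C A B" if "f \<in> Hom C A B" for f B
    using Comp_Ident[OF that] Comp_Zero[OF assms that] I by simp
  moreover have "f = Zero C B A" if "f \<in> Hom C B A" for f B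
    using Ident_Comp[OF that] Zero_Comp[OF assms that] I by simp
  ultimately show "zero_object C A"
    using assms Zero_Hom unfolding zero_object_def by blast
qed

text \<open>The inclusion into a zero object is zero; being monic and annihilating the identity of
  \<open>Dom C x\<close>, it forces that identity to vanish.\<close>

lemma zero_object_sub_le:
  assumes "subobject C M x" "subobject C M y" "sub_le C x y" "zero_object C (Dom C y)"
  shows "zero_object C (Dom C x)"
proof -
  note u = sub_incl[OF assms(3,2)]
  note X = Hom_Obj_Dom[OF u(1)] and Y = Hom_Obj_Cod[OF u(1)]
  have "sub_incl C x y = Zero C (Dom C x) (Dom C y)"
    using Ident_Comp[OF u(1)] Zero_Comp[OF Y u(1)] zero_object_iff[OF Y] assms(4) by simp
  then have "sub_incl C x y \<cdot> Ident C (Dom C x) = Zero C (Dom C x) (Dom C y)"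
    using Comp_Ident[OF u(1)] by simp
  then have "Ident C (Dom C x) = Zero C (Dom C x) (Dom C x)"
    using subobject_of_le[OF assms(1-3)] mono_iff[OF u(1)] Ident_Hom[OF X]
    unfolding subobject_def by blast
  then show ?thesis using zero_object_iff[OF X] by simp
qed

lemma is_kernelD:
  assumes "is_kernel C f k" "f \<in> Hom C A B"
  shows "subobject C A k" "k \<in> Hom C (Dom C k) A" "f \<cdot> k = Zero C (Dom C k) B"
    "\<And>g X. g \<in> Hom C X A \<Longrightarrow> f \<cdot> g = Zero C X B \<Longrightarrow> \<exists>h\<in>Hom C X (Dom C k). k \<cdot> h = g"
proof -
  show k: "k \<in> Hom C (Dom C k) A" and fk: "f \<cdot> k = Zero C (Dom C k) B"
    using assms by (auto simp: is_kernel_def Hom_def)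
  have U: "\<exists>!h. h \<in> Hom C X (Dom C k) \<and> k \<cdot> h = g"
    if "g \<in> Hom C X A" "f \<cdot> g = Zero C X B" for g X
    using assms that Hom_Obj_Dom[OF that(1)] unfolding is_kernel_def
    by (metis Hom_Dom Hom_Cod)
  then show "\<exists>h\<in>Hom C X (Dom C k). k \<cdot> h = g"
    if "g \<in> Hom C X A" "f \<cdot> g = Zero C X B" for g X using that by blast
  \<comment> \<open>Uniqueness in the universal property amounts to monicity of \<open>k\<close>:
    both \<open>s\<close> and \<open>t\<close> factor the morphism \<open>k \<cdot> s\<close>, which
    \<open>f\<close> annihilates.\<close>
  have "s = t" if "s \<in> Hom C X (Dom C k)" "t \<in> Hom C X (Dom C k)" "k \<cdot> s = k \<cdot> t" for X s t
  proof -
    have "f \<cdot> (k \<cdot> s) = Zero C X B"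
      using Comp_assoc[OF that(1) k assms(2)] fk Zero_Comp[OF Hom_Obj_Cod[OF assms(2)] that(1)] by simp
    from U[OF Comp_Hom[OF that(1) k] this] that show ?thesis by metis
  qed
  then have "mono_arr C k" using k unfolding mono_arr_def by (metis Hom_Arr)
  then show "subobject C A k" using k by (simp add: subobject_def Hom_Cod)
qed

lemma is_cokernelD:
  assumes "is_cokernel C f q" "f \<in> Hom C A B"
  shows "epi_arr C q" "q \<in> Hom C B (Cod C q)" "q \<cdot> f = Zero C A (Cod C q)"
    "\<And>g X. g \<in> Hom C B X \<Longrightarrow> g \<cdot> f = Zero C A X \<Longrightarrow> \<exists>h\<in>Hom C (Cod C q) X. h \<cdot> q = g"
proof -
  show q: "q \<in> Hom C B (Cod C q)" and qf: "q \<cdot> f = Zero C A (Cod C q)"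
    using assms by (auto simp: is_cokernel_def Hom_def)
  have U: "\<exists>!h. h \<in> Hom C (Cod C q) X \<and> h \<cdot> q = g"
    if "g \<in> Hom C B X" "g \<cdot> f = Zero C A X" for g X
    using assms that Hom_Obj_Cod[OF that(1)] unfolding is_cokernel_def
    by (metis Hom_Dom Hom_Cod)
  then show "\<exists>h\<in>Hom C (Cod C q) X. h \<cdot> q = g"
    if "g \<in> Hom C B X" "g \<cdot> f = Zero C A X" for g X using that by blast
  have "s = t" if "s \<in> Hom C (Cod C q) X" "t \<in> Hom C (Cod C q) X" "s \<cdot> q = t \<cdot> q" for X s t
  proof -
    have "(s \<cdot> q) \<cdot> f = Zero C A X"
      using Comp_assoc[OF assms(2) q that(1)] qf Comp_Zero[OF Hom_Obj_Dom[OF assms(2)] that(1)] by simp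
    from U[OF Comp_Hom[OF q that(1)] this] that show ?thesis by metis
  qed
  then show "epi_arr C q" using q unfolding epi_arr_def by (metis Hom_Arr)
qed

end

section \<open>Subobjects as kernels, and images\<close>

context abelian_category
begin

lemma Ker: "f \<in> Hom C A B \<Longrightarrow> is_kernel C f (Ker C f)"
  unfolding Ker_def by (rule someI_ex) (rule ex_kernel[OF Hom_Arr])

lemma Coker: "f \<in> Hom C A B \<Longrightarrow> is_cokernel C f (Coker C f)"
  unfolding Coker_def by (rule someI_ex) (rule ex_cokernel[OF Hom_Arr])

lemma subobject_Ker: "f \<in> Hom C A B \<Longrightarrow> subobject C A (Ker C f)"
  by (rule is_kernelD(1)[OF Ker])

lemma subobject_normal:
  assumes "subobject C M l"
  obtains B g where "g \<in> Hom C M B" "is_kernel C g l"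
proof -
  obtain g where g: "is_kernel C g l" using mono_normal assms unfolding subobject_def by blast
  then have "g \<in> Hom C M (Cod C g)"
    using assms unfolding is_kernel_def subobject_def Hom_def by auto
  with g that show ?thesis by blast
qed

lemma sub_le_kernel_iff:
  assumes "is_kernel C g l" "g \<in> Hom C M B" "x \<in> Hom C X M"
  shows "sub_le C x l \<longleftrightarrow> g \<cdot> x = Zero C X B"
proof
  note k = is_kernelD[OF assms(1,2)]
  assume "sub_le C x l"
  then obtain u where u: "u \<in> Hom C X (Dom C l)" "l \<cdot> u = x"
    using Hom_Dom[OF assms(3)] unfolding sub_le_def by auto
  show "g \<cdot> x = Zero C X B"
    using Comp_assoc[OF u(1) k(2) assms(2)] u(2) k(3) Zero_Comp[OF Hom_Obj_Cod[OF assms(2)] u(1)]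
    by simp
next
  assume "g \<cdot> x = Zero C X B"
  then show "sub_le C x l"
    using is_kernelD(4)[OF assms] Hom_Dom[OF assms(3)] unfolding sub_le_def by auto
qed

lemma sub_le_Ker_iff:
  assumes "f \<in> Hom C A B" "x \<in> Hom C X A"
  shows "sub_le C x (Ker C f) \<longleftrightarrow> f \<cdot> x = Zero C X B"
  by (rule sub_le_kernel_iff[OF Ker[OF assms(1)] assms])

text \<open>By normality \<open>e\<close> is the cokernel of some \<open>f\<close>, which factors
  through \<open>Ker C e\<close> because \<open>e\<close> annihilates it. So whatever annihilates
  the kernel annihilates \<open>f\<close> and descends along \<open>e\<close>.\<close>

lemma epi_cokernel_of_Ker:
  assumes "epi_arr C e" "e \<in> Hom C A B" "g \<in> Hom C A X" "g \<cdot> Ker C e = Zero C (Dom C (Ker C e)) X"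
  shows "\<exists>h\<in>Hom C B X. h \<cdot> e = g"
proof -
  obtain f where f: "is_cokernel C f e" using epi_normal assms by blast
  then have fH: "f \<in> Hom C (Dom C f) A"
    using assms(2) unfolding is_cokernel_def Hom_def by auto
  note k = is_kernelD[OF Ker[OF assms(2)] assms(2)]
  have "e \<cdot> f = Zero C (Dom C f) B"
    using is_cokernelD(3)[OF f fH] Hom_Cod[OF assms(2)] by simp
  then obtain u where u: "u \<in> Hom C (Dom C f) (Dom C (Ker C e))" "Ker C e \<cdot> u = f"
    using k(4)[OF fH] by blast
  have "g \<cdot> f = Zero C (Dom C f) X"
    using Comp_assoc[OF u(1) k(2) assms(3)] u(2) assms(4) Zero_Comp[OF Hom_Obj_Cod[OF assms(3)] u(1)]
    by simp
  then show ?thesis using is_cokernelD(4)[OF f fH assms(3)] Hom_Cod[OF assms(2)] by simp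
qed

lemma Img_Hom:
  assumes "f \<in> Hom C A B"
  shows "subobject C B (Img C f)" "Img C f \<in> Hom C (Dom C (Img C f)) B"
  using is_kernelD(1,2)[OF Ker is_cokernelD(2)[OF Coker[OF assms] assms]]
    is_cokernelD(2)[OF Coker[OF assms] assms]
  unfolding Img_def by blast+

lemma Img_factor:
  assumes f: "f \<in> Hom C A B"
  shows "\<exists>e\<in>Hom C A (Dom C (Img C f)). Img C f \<cdot> e = f"
proof -
  note q = is_cokernelD[OF Coker[OF f] f]
  show ?thesis using is_kernelD(4)[OF Ker[OF q(2)] q(2) f q(3)] unfolding Img_def by blast
qed

text \<open>\<open>Img C f\<close> is the kernel of \<open>Coker C f\<close>. A morphism
  annihilating \<open>f\<close> factors through that cokernel and so annihilates its kernel;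
  conversely, \<open>f\<close> factors through its image.\<close>

lemma Comp_Img_Zero_iff:
  assumes f: "f \<in> Hom C A B" and g: "g \<in> Hom C B X"
  shows "g \<cdot> Img C f = Zero C (Dom C (Img C f)) X \<longleftrightarrow> g \<cdot> f = Zero C A X"
proof
  note m = Img_Hom[OF f]
  obtain e where e: "e \<in> Hom C A (Dom C (Img C f))" "Img C f \<cdot> e = f" using Img_factor[OF f] by blast
  assume "g \<cdot> Img C f = Zero C (Dom C (Img C f)) X"
  then show "g \<cdot> f = Zero C A X"
    using Comp_assoc[OF e(1) m(2) g] e(2) Zero_Comp[OF Hom_Obj_Cod[OF g] e(1)] by simp
next
  note q = is_cokernelD[OF Coker[OF f] f]
  note m = is_kernelD[OF Ker[OF q(2)] q(2), folded Img_def]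
  assume "g \<cdot> f = Zero C A X"
  then obtain h where h: "h \<in> Hom C (Cod C (Coker C f)) X" "h \<cdot> Coker C f = g"
    using q(4)[OF g] by blast
  show "g \<cdot> Img C f = Zero C (Dom C (Img C f)) X"
    using Comp_assoc[OF m(2) q(2) h(1)] h(2) m(3) Comp_Zero[OF Hom_Obj_Dom[OF m(2)] h(1)] by simp
qed

text \<open>The image is the least subobject through which \<open>f\<close> factors. If
  \<open>t\<close> annihilates \<open>e\<close>, then \<open>f\<close> already factors through the
  kernel of \<open>t\<close> inside the image; this smaller subobject must be the whole image, so
  \<open>t\<close> vanishes.\<close>

lemma Img_epi:
  assumes f: "f \<in> Hom C A B" and e: "e \<in> Hom C A (Dom C (Img C f))" "Img C f \<cdot> e = f"
  shows "epi_arr C e"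
  unfolding epi_iff[OF e(1)]
proof (intro allI ballI impI)
  fix X t assume t: "t \<in> Hom C (Dom C (Img C f)) X" "t \<cdot> e = Zero C A X"
  note m = Img_Hom[OF f]
  note j = is_kernelD[OF Ker[OF t(1)] t(1)]
  note mj = Comp_Hom[OF j(2) m(2)]
  obtain e' where e': "e' \<in> Hom C A (Dom C (Ker C t))" "Ker C t \<cdot> e' = e"
    using j(4)[OF e(1) t(2)] by blast
  have "subobject C B (Img C f \<cdot> Ker C t)"
    using mono_Comp[OF _ _ j(2) m(2)] j(1) m(1) Hom_Cod[OF mj] unfolding subobject_def by blast
  \<comment> \<open>The smaller subobject is the kernel of some \<open>h\<close>. As
    \<open>h\<close> annihilates \<open>f\<close>, it annihilates the image as well, so the image
    factors back through the smaller subobject and \<open>Ker C t\<close> acquires a right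
    inverse.\<close>
  then obtain Y h where h: "h \<in> Hom C B Y" "is_kernel C h (Img C f \<cdot> Ker C t)"
    by (rule subobject_normal)
  note l = is_kernelD[OF h(2,1), unfolded Hom_Dom[OF mj]]
  have "(Img C f \<cdot> Ker C t) \<cdot> e' = f"
    using Comp_assoc[OF e'(1) j(2) m(2)] e' e by simp
  then have "h \<cdot> f = Zero C A Y"
    using Comp_assoc[OF e'(1) mj h(1)] l(3) Zero_Comp[OF Hom_Obj_Cod[OF h(1)] e'(1)] by simp
  then have "h \<cdot> Img C f = Zero C (Dom C (Img C f)) Y" using Comp_Img_Zero_iff[OF f h(1)] by simp
  then obtain s where s: "s \<in> Hom C (Dom C (Img C f)) (Dom C (Ker C t))"
      "(Img C f \<cdot> Ker C t) \<cdot> s = Img C f"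
    using l(4)[OF m(2)] by blast
  note I = Ident_Hom[OF Hom_Obj_Dom[OF m(2)]]
  have "Ker C t \<cdot> s = Ident C (Dom C (Img C f))"
    using m(1) Comp_assoc[OF s(1) j(2) m(2)] s(2) Comp_Ident[OF m(2)]
      mono_cancel[OF _ m(2) Comp_Hom[OF s(1) j(2)] I] unfolding subobject_def by simp
  then have "t = t \<cdot> (Ker C t \<cdot> s)" using Comp_Ident[OF t(1)] by simp
  also have "\<dots> = Zero C (Dom C (Img C f)) X"
    using Comp_assoc[OF s(1) j(2) t(1)] j(3) Zero_Comp[OF Hom_Obj_Cod[OF t(1)] s(1)] by simp
  finally show "t = Zero C (Dom C (Img C f)) X" .
qed

section \<open>The test for the whole object, and binary intersections and sums\<close>

lemma sub_eq_Ident_iff: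
  assumes "subobject C M c"
  shows "sub_eq C c (Ident C M) \<longleftrightarrow>
    (\<forall>X. \<forall>g\<in>Hom C M X. g \<cdot> c = Zero C (Dom C c) X \<longrightarrow> g = Zero C M X)" (is "_ \<longleftrightarrow> ?R")
proof
  note c = subobject_Hom[OF assms]
  note M = Hom_Obj_Cod[OF c]
  assume "sub_eq C c (Ident C M)"
  then obtain s where s: "s \<in> Hom C M (Dom C c)" "c \<cdot> s = Ident C M"
    using Hom_Dom[OF Ident_Hom[OF M]] unfolding sub_eq_def sub_le_def by auto
  show ?R
  proof (intro allI ballI impI)
    fix X g assume g: "g \<in> Hom C M X" "g \<cdot> c = Zero C (Dom C c) X"
    have "g = g \<cdot> (c \<cdot> s)" using s(2) Comp_Ident[OF g(1)] by simp
    also have "\<dots> = Zero C M X"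
      using Comp_assoc[OF s(1) c g(1)] g(2) Zero_Comp[OF Hom_Obj_Cod[OF g(1)] s(1)] by simp
    finally show "g = Zero C M X" .
  qed
next
  note M = Hom_Obj_Cod[OF subobject_Hom[OF assms]]
  assume R: ?R
  obtain B g where g: "g \<in> Hom C M B" "is_kernel C g c" by (rule subobject_normal[OF assms])
  \<comment> \<open>The assumption is applied to the very \<open>g\<close> whose kernel is
    \<open>c\<close>: it vanishes, so its kernel contains the identity.\<close>
  have "g \<cdot> Ident C M = Zero C M B"
    using R is_kernelD(3)[OF g(2,1)] g(1) Comp_Ident[OF g(1)] by simp
  then have "sub_le C (Ident C M) c" using sub_le_kernel_iff[OF g(2,1) Ident_Hom[OF M]] by simp
  then show "sub_eq C c (Ident C M)" using sub_le_Ident[OF assms] by (simp add: sub_eq_def)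
qed

text \<open>The intersection is the pullback of \<open>a\<close> along \<open>c\<close>: with
  \<open>a\<close> the kernel of \<open>g\<close>, take the kernel of \<open>g \<cdot> c\<close> and
  follow it by \<open>c\<close>.\<close>

lemma is_intersection_binary:
  assumes "subobject C M a" "subobject C M c"
  shows "is_intersection C M {a, c} (sub_inter C M {a, c})"
proof -
  note aH = subobject_Hom[OF assms(1)] and cH = subobject_Hom[OF assms(2)]
  obtain B g where g: "g \<in> Hom C M B" "is_kernel C g a" by (rule subobject_normal[OF assms(1)])
  note gc = Comp_Hom[OF cH g(1)]
  let ?j = "Ker C (g \<cdot> c)"
  note j = is_kernelD[OF Ker[OF gc] gc]
  note k = Comp_Hom[OF j(2) cH]
  have s: "subobject C M (c \<cdot> ?j)"
    using mono_Comp[OF _ _ j(2) cH] j(1) assms(2) Hom_Cod[OF k] unfolding subobject_def by blast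
  have "sub_le C (c \<cdot> ?j) a"
    using sub_le_kernel_iff[OF g(2,1) k] Comp_assoc[OF j(2) cH g(1)] j(3) by simp
  moreover have "sub_le C (c \<cdot> ?j) c" using j(2) Hom_Dom[OF k] unfolding sub_le_def by auto
  moreover have "sub_le C l (c \<cdot> ?j)" if l: "subobject C M l" "sub_le C l a" "sub_le C l c" for l
  proof -
    obtain u where u: "u \<in> Hom C (Dom C l) (Dom C c)" "c \<cdot> u = l" using l(3) unfolding sub_le_def by blast
    have "g \<cdot> l = Zero C (Dom C l) B"
      using l(2) sub_le_kernel_iff[OF g(2,1) subobject_Hom[OF l(1)]] by simp
    then have "(g \<cdot> c) \<cdot> u = Zero C (Dom C l) B" using Comp_assoc[OF u(1) cH g(1)] u(2) by simp
    then obtain h where h: "h \<in> Hom C (Dom C l) (Dom C ?j)" "?j \<cdot> h = u" using j(4)[OF u(1)] by blast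
    then show ?thesis
      using Comp_assoc[OF h(1) j(2) cH] u(2) Hom_Dom[OF k] unfolding sub_le_def by auto
  qed
  ultimately have "is_intersection C M {a, c} (c \<cdot> ?j)" using s unfolding is_intersection_def by auto
  then show ?thesis unfolding sub_inter_def by (rule someI)
qed

text \<open>Subobjects are kernels, so an upper bound of \<open>S\<close> is tested by the morphisms that
  annihilate \<open>S\<close>; the sum is then the image of any \<open>\<phi>\<close> annihilated by the same morphisms.\<close>

lemma is_sum_Img:
  assumes \<phi>: "\<phi> \<in> Hom C P M" and S: "\<And>s. s \<in> S \<Longrightarrow> subobject C M s"
    and iff: "\<And>X g. g \<in> Hom C M X \<Longrightarrow>
      g \<cdot> \<phi> = Zero C P X \<longleftrightarrow> (\<forall>s\<in>S. g \<cdot> s = Zero C (Dom C s) X)"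
  shows "is_sum C M S (Img C \<phi>)"
proof -
  note m = Img_Hom[OF \<phi>]
  have "sub_le C (Img C \<phi>) l \<longleftrightarrow> (\<forall>s\<in>S. sub_le C s l)" if l: "subobject C M l" for l
  proof -
    obtain B g where g: "g \<in> Hom C M B" "is_kernel C g l" by (rule subobject_normal[OF l])
    have "sub_le C (Img C \<phi>) l \<longleftrightarrow> g \<cdot> \<phi> = Zero C P B"
      using sub_le_kernel_iff[OF g(2,1) m(2)] Comp_Img_Zero_iff[OF \<phi> g(1)] by simp
    also have "\<dots> \<longleftrightarrow> (\<forall>s\<in>S. sub_le C s l)"
      using iff[OF g(1)] sub_le_kernel_iff[OF g(2,1) subobject_Hom[OF S]] by simp
    finally show ?thesis .
  qed
  moreover have "sub_le C (Img C \<phi>) (Img C \<phi>)"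
    using Ident_Hom[OF Hom_Obj_Dom[OF m(2)]] Comp_Ident[OF m(2)] unfolding sub_le_def by blast
  ultimately show ?thesis using m(1) unfolding is_sum_def by blast
qed

text \<open>The sum is the image of the morphism out of the biproduct with components
  \<open>a\<close> and \<open>c\<close>, since annihilating that morphism means annihilating both
  components.\<close>

lemma is_sum_binary:
  assumes "subobject C M a" "subobject C M c"
  shows "is_sum C M {a, c} (sub_sum C M {a, c})"
proof -
  note a = subobject_Hom[OF assms(1)] and c = subobject_Hom[OF assms(2)]
  obtain P i j p q where bp: "is_biproduct C (Dom C a) (Dom C c) P i j p q"
    using ex_biproduct[OF Hom_Obj_Dom[OF a] Hom_Obj_Dom[OF c]] by blast
  then have H: "i \<in> Hom C (Dom C a) P" "j \<in> Hom C (Dom C c) P"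
      "p \<in> Hom C P (Dom C a)" "q \<in> Hom C P (Dom C c)"
    and E: "p \<cdot> i = Ident C (Dom C a)" "q \<cdot> j = Ident C (Dom C c)"
      "p \<cdot> j = Zero C (Dom C c) (Dom C a)" "q \<cdot> i = Zero C (Dom C a) (Dom C c)"
    unfolding is_biproduct_def by blast+
  let ?\<phi> = "Add C (a \<cdot> p) (c \<cdot> q)"
  note ap = Comp_Hom[OF H(3) a] and cq = Comp_Hom[OF H(4) c]
  note \<phi> = Add_Hom[OF ap cq]
  note P = Hom_Obj_Dom[OF H(3)] and M = Hom_Obj_Cod[OF a]
  have "Add C a (Zero C (Dom C a) M) = a"
  proof -
    interpret G: comm_group "Hom_group C (Dom C a) M"
      by (rule Hom_comm_group[OF Hom_Obj_Dom[OF a] M])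
    show ?thesis using G.r_one[of a] a by (simp add: Hom_group_def)
  qed
  then have \<phi>i: "?\<phi> \<cdot> i = a"
    using Add_Comp[OF H(1) ap cq] Comp_assoc[OF H(1,3) a] Comp_assoc[OF H(1,4) c] E
      Comp_Ident[OF a] Comp_Zero[OF Hom_Obj_Dom[OF a] c] by simp
  have \<phi>j: "?\<phi> \<cdot> j = c"
    using Add_Comp[OF H(2) ap cq] Comp_assoc[OF H(2,3) a] Comp_assoc[OF H(2,4) c] E
      Comp_Ident[OF c] Comp_Zero[OF Hom_Obj_Dom[OF c] a] Zero_Add[OF c] by simp
  have "g \<cdot> ?\<phi> = Zero C P X \<longleftrightarrow> (\<forall>s\<in>{a, c}. g \<cdot> s = Zero C (Dom C s) X)"
    if g: "g \<in> Hom C M X" for X g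
  proof
    note X = Hom_Obj_Cod[OF g]
    assume "g \<cdot> ?\<phi> = Zero C P X"
    then show "\<forall>s\<in>{a, c}. g \<cdot> s = Zero C (Dom C s) X"
      using Comp_assoc[OF H(1) \<phi> g] Comp_assoc[OF H(2) \<phi> g] \<phi>i \<phi>j
        Zero_Comp[OF X H(1)] Zero_Comp[OF X H(2)] by simp
  next
    note X = Hom_Obj_Cod[OF g]
    assume "\<forall>s\<in>{a, c}. g \<cdot> s = Zero C (Dom C s) X"
    then have "g \<cdot> (a \<cdot> p) = Zero C P X" "g \<cdot> (c \<cdot> q) = Zero C P X"
      using Comp_assoc[OF H(3) a g] Comp_assoc[OF H(4) c g] Zero_Comp[OF X H(3)] Zero_Comp[OF X H(4)]
      by simp_all
    then show "g \<cdot> ?\<phi> = Zero C P X"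
      using Comp_Add[OF ap cq g] Zero_Add[OF Zero_Hom[OF P X]] by simp
  qed
  then have "is_sum C M {a, c} (Img C ?\<phi>)"
    by (rule is_sum_Img[OF \<phi>, rotated]) (use assms in auto)
  then show ?thesis unfolding sub_sum_def by (rule someI)
qed

text \<open>A morphism annihilates the sum iff its kernel contains both summands, so the test for
  the whole object can be made on \<open>a\<close> and \<open>c\<close> separately and the
  representative chosen by \<open>sub_sum\<close> drops out.\<close>

lemma sub_sum_eq_Ident_iff:
  assumes "subobject C M a" "subobject C M c"
  shows "sub_eq C (sub_sum C M {a, c}) (Ident C M) \<longleftrightarrow>
    (\<forall>X. \<forall>g\<in>Hom C M X. g \<cdot> a = Zero C (Dom C a) X \<and> g \<cdot> c = Zero C (Dom C c) X \<longrightarrow> g = Zero C M X)"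
proof -
  let ?s = "sub_sum C M {a, c}"
  note sum = is_sum_binary[OF assms]
  then have s: "subobject C M ?s" unfolding is_sum_def by blast
  have "g \<cdot> ?s = Zero C (Dom C ?s) X \<longleftrightarrow> g \<cdot> a = Zero C (Dom C a) X \<and> g \<cdot> c = Zero C (Dom C c) X"
    if g: "g \<in> Hom C M X" for X g
  proof -
    have "sub_le C ?s (Ker C g) \<longleftrightarrow> sub_le C a (Ker C g) \<and> sub_le C c (Ker C g)"
      using sum subobject_Ker[OF g] sub_le_trans[OF _ _ Hom_Arr[OF subobject_Hom[OF subobject_Ker[OF g]]]]
      unfolding is_sum_def by blast
    then show ?thesis
      using sub_le_Ker_iff[OF g subobject_Hom] s assms by simp
  qed
  then show ?thesis unfolding sub_eq_Ident_iff[OF s] by blast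
qed

section \<open>Quotients and the relation of lying above\<close>

lemma sub_quotient:
  assumes x: "subobject C N x" and y: "subobject C N y" and le: "sub_le C x y"
  defines "p \<equiv> Coker C (sub_incl C x y)" and "q \<equiv> Coker C x"
  shows "sub_quotient C y x \<in> Hom C (Cod C p) (Cod C q)" "sub_quotient C y x \<cdot> p = q \<cdot> y"
    "mono_arr C (sub_quotient C y x)"
proof -
  let ?k = "sub_quotient C y x"
  note xH = subobject_Hom[OF x] and yH = subobject_Hom[OF y]
  note u = sub_incl[OF le y]
  note P = is_cokernelD[OF Coker[OF u(1)] u(1), folded p_def]
  note Q = is_cokernelD[OF Coker[OF xH] xH, folded q_def]
  note qy = Comp_Hom[OF yH Q(2)]
  have "(q \<cdot> y) \<cdot> sub_incl C x y = Zero C (Dom C x) (Cod C q)"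
    using Comp_assoc[OF u(1) yH Q(2)] u(2) Q(3) by simp
  \<comment> \<open>The morphism exists because \<open>q \<cdot> y\<close> annihilates the inclusion
    of \<open>x\<close> in \<open>y\<close>, and is unique because \<open>p\<close> is epi.\<close>
  then have "\<exists>!k. k \<in> Hom C (Cod C p) (Cod C q) \<and> k \<cdot> p = q \<cdot> y"
    using P(4)[OF qy] epi_cancel[OF P(1,2)] by metis
  from theI'[OF this] show k: "?k \<in> Hom C (Cod C p) (Cod C q)" and kp: "?k \<cdot> p = q \<cdot> y"
    unfolding sub_quotient_def p_def q_def Let_def by blast+
  \<comment> \<open>Both \<open>p\<close> and the epi part \<open>e\<close> of \<open>q \<cdot> y\<close> are cokernels of the inclusion of \<open>x\<close> in \<open>y\<close>,
    so the induced morphism is the image of \<open>q \<cdot> y\<close> up to isomorphism.\<close>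
  let ?m = "Img C (q \<cdot> y)"
  note m = Img_Hom[OF qy]
  obtain e where e: "e \<in> Hom C (Dom C y) (Dom C ?m)" "?m \<cdot> e = q \<cdot> y" using Img_factor[OF qy] by blast
  have epi: "epi_arr C e" by (rule Img_epi[OF qy e])
  note j = is_kernelD[OF Ker[OF e(1)] e(1)]
  note yj = Comp_Hom[OF j(2) yH]
  \<comment> \<open>The aim is to factor \<open>y \<cdot> Ker C e\<close> through \<open>x\<close>.
    Vanishing under \<open>q\<close> suffices: \<open>x\<close> is the kernel of some
    \<open>g\<close>, and \<open>g\<close> factors through the cokernel \<open>q\<close> of
    \<open>x\<close>.\<close>
  have "q \<cdot> (y \<cdot> Ker C e) = Zero C (Dom C (Ker C e)) (Cod C q)"
    using Comp_assoc[OF j(2) yH Q(2)] Comp_assoc[OF j(2) e(1) m(2)] e(2) j(3)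
      Comp_Zero[OF Hom_Obj_Dom[OF j(2)] m(2)] by simp
  moreover obtain B g where g: "g \<in> Hom C N B" "is_kernel C g x" by (rule subobject_normal[OF x])
  moreover obtain h where h: "h \<in> Hom C (Cod C q) B" "h \<cdot> q = g"
    using Q(4)[OF g(1) is_kernelD(3)[OF g(2,1)]] by blast
  ultimately have "g \<cdot> (y \<cdot> Ker C e) = Zero C (Dom C (Ker C e)) B"
    using Comp_assoc[OF yj Q(2) h(1)] Comp_Zero[OF Hom_Obj_Dom[OF j(2)] h(1)] by simp
  then obtain s where s: "s \<in> Hom C (Dom C (Ker C e)) (Dom C x)" "x \<cdot> s = y \<cdot> Ker C e"
    using is_kernelD(4)[OF g(2,1) yj] by blast
  have us: "sub_incl C x y \<cdot> s = Ker C e"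
    using mono_cancel[OF _ yH Comp_Hom[OF s(1) u(1)] j(2)] y Comp_assoc[OF s(1) u(1) yH] u(2) s(2)
    unfolding subobject_def by simp
  have "p \<cdot> Ker C e = Zero C (Dom C (Ker C e)) (Cod C p)"
    using Comp_assoc[OF s(1) u(1) P(2)] us P(3) Zero_Comp[OF Hom_Obj_Cod[OF P(2)] s(1)] by simp
  then obtain t where t: "t \<in> Hom C (Dom C ?m) (Cod C p)" "t \<cdot> e = p"
    using epi_cokernel_of_Ker[OF epi e(1) P(2)] by blast
  have "(?k \<cdot> t) \<cdot> e = ?m \<cdot> e" using Comp_assoc[OF e(1) t(1) k] t(2) kp e(2) by simp
  then have kt: "?k \<cdot> t = ?m" using epi_cancel[OF epi e(1) Comp_Hom[OF t(1) k] m(2)] by simp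
  have "?m \<cdot> (e \<cdot> sub_incl C x y) = Zero C (Dom C x) (Cod C q)"
    using Comp_assoc[OF u(1) e(1) m(2)] e(2) \<open>(q \<cdot> y) \<cdot> sub_incl C x y = _\<close> by simp
  then have "e \<cdot> sub_incl C x y = Zero C (Dom C x) (Dom C ?m)"
    using m(1) mono_iff[OF m(2)] Comp_Hom[OF u(1) e(1)] unfolding subobject_def by blast
  then obtain r where r: "r \<in> Hom C (Cod C p) (Dom C ?m)" "r \<cdot> p = e" using P(4)[OF e(1)] by blast
  have tr: "t \<cdot> r = Ident C (Cod C p)"
    using epi_cancel[OF P(1,2) Comp_Hom[OF r(1) t(1)] Ident_Hom[OF Hom_Obj_Cod[OF P(2)]]]
      Comp_assoc[OF P(2) r(1) t(1)] r(2) t(2) Ident_Comp[OF P(2)] by simp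
  have mr: "?m \<cdot> r = ?k"
    using Comp_assoc[OF r(1) t(1) k] kt tr Comp_Ident[OF k] by simp
  \<comment> \<open>The one-sided inverse is enough: it makes \<open>r\<close> a split monomorphism,
    and \<open>?k\<close> is \<open>r\<close> followed by the image.\<close>
  have "mono_arr C (t \<cdot> r)"
    using subobject_Ident[OF Hom_Obj_Cod[OF P(2)]] tr unfolding subobject_def by simp
  then have "mono_arr C r" by (rule mono_factor[OF _ r(1) t(1)])
  then show "mono_arr C ?k" using mono_Comp[OF _ _ r(1) m(2)] m(1) mr unfolding subobject_def by simp
qed

text \<open>A subobject of \<open>N/X\<close> is the kernel of an epimorphism \<open>N/X \<rightarrow> Z\<close>, that is, of an
  epimorphism \<open>r : N \<rightarrow> Z\<close> with \<open>r \<cdot> x = 0\<close>; its sum with \<open>Y/X\<close> is everything iff \<open>r \<cdot> y\<close> is epi.\<close>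

lemma lies_above_iff:
  assumes x: "subobject C N x" and y: "subobject C N y"
  shows "lies_above C y x \<longleftrightarrow> sub_le C x y \<and>
    (\<forall>Z. \<forall>r\<in>Hom C N Z. epi_arr C r \<and> r \<cdot> x = Zero C (Dom C x) Z \<and> epi_arr C (r \<cdot> y) \<longrightarrow>
      r = Zero C N Z)"
proof (cases "sub_le C x y")
  case le: True
  let ?k = "sub_quotient C y x" and ?p = "Coker C (sub_incl C x y)" and ?q = "Coker C x"
  note xH = subobject_Hom[OF x] and yH = subobject_Hom[OF y]
  note u = sub_incl[OF le y]
  note P = is_cokernelD[OF Coker[OF u(1)] u(1)]
  note Q = is_cokernelD[OF Coker[OF xH] xH]
  note k = sub_quotient[OF x y le]
  let ?B = "Cod C ?q"
  have ks: "subobject C ?B ?k" using k(3) Hom_Cod[OF k(1)] by (simp add: subobject_def)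
  \<comment> \<open>Precomposing with the epimorphism \<open>?p\<close> loses nothing, so a
    condition on \<open>Y/X\<close> becomes one on \<open>Y\<close>.\<close>
  have k0: "g \<cdot> ?k = Zero C (Dom C ?k) X \<longleftrightarrow> (g \<cdot> ?q) \<cdot> y = Zero C (Dom C y) X"
    if g: "g \<in> Hom C ?B X" for g X
  proof -
    have gk: "g \<cdot> ?k \<in> Hom C (Cod C ?p) X" by (rule Comp_Hom[OF k(1) g])
    have e: "(g \<cdot> ?q) \<cdot> y = (g \<cdot> ?k) \<cdot> ?p"
      using Comp_assoc[OF yH Q(2) g] Comp_assoc[OF P(2) k(1) g] k(2) by simp
    show ?thesis
    proof
      assume "g \<cdot> ?k = Zero C (Dom C ?k) X"
      then show "(g \<cdot> ?q) \<cdot> y = Zero C (Dom C y) X"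
        unfolding e using Zero_Comp[OF Hom_Obj_Cod[OF g] P(2)] Hom_Dom[OF k(1)] by simp
    next
      assume "(g \<cdot> ?q) \<cdot> y = Zero C (Dom C y) X"
      then show "g \<cdot> ?k = Zero C (Dom C ?k) X"
        using epi_iff[OF P(2)] P(1) gk e Hom_Dom[OF k(1)] by simp
    qed
  qed
  \<comment> \<open>Superfluity freed of sums and of \<open>?k\<close>: \<open>?J c\<close> says
    that \<open>c\<close> and \<open>Y/X\<close> together generate \<open>N/X\<close>, and
    \<open>?E c\<close> that \<open>c\<close> alone does.\<close>
  have sf: "superfluous C ?k \<longleftrightarrow>
    (\<forall>c. subobject C ?B c \<and>
      (\<forall>X. \<forall>g\<in>Hom C ?B X. (g \<cdot> ?q) \<cdot> y = Zero C (Dom C y) X \<and> g \<cdot> c = Zero C (Dom C c) X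
        \<longrightarrow> g = Zero C ?B X) \<longrightarrow>
      (\<forall>X. \<forall>g\<in>Hom C ?B X. g \<cdot> c = Zero C (Dom C c) X \<longrightarrow> g = Zero C ?B X))"
    (is "_ \<longleftrightarrow> (\<forall>c. ?S c \<and> ?J c \<longrightarrow> ?E c)")
  proof -
    have "(?S c \<and> sub_eq C (sub_sum C ?B {?k, c}) (Ident C ?B) \<longrightarrow> sub_eq C c (Ident C ?B))
        \<longleftrightarrow> (?S c \<and> ?J c \<longrightarrow> ?E c)" for c
    proof (cases "?S c")
      case True
      have "sub_eq C (sub_sum C ?B {?k, c}) (Ident C ?B) \<longleftrightarrow> ?J c"
        unfolding sub_sum_eq_Ident_iff[OF ks True] using k0 by simp
      then show ?thesis using True by (simp only: sub_eq_Ident_iff[OF True])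
    qed (simp only: simp_thms)
    then show ?thesis using k(3) by (simp only: superfluous_def Hom_Cod[OF k(1)] simp_thms)
  qed
  show ?thesis
  proof (intro iffI conjI allI ballI impI)
    show "sub_le C x y" by (rule le)
    fix Z r
    assume la: "lies_above C y x" and r: "r \<in> Hom C N Z"
      and A: "epi_arr C r \<and> r \<cdot> x = Zero C (Dom C x) Z \<and> epi_arr C (r \<cdot> y)"
    obtain h where h: "h \<in> Hom C ?B Z" "h \<cdot> ?q = r" using Q(4)[OF r] A by blast
    have eh: "epi_arr C h" using epi_factor[OF _ Q(2) h(1)] h(2) A by simp
    \<comment> \<open>The quotient of \<open>N/X\<close> by this subobject is \<open>Z\<close>.
      Together with \<open>Y/X\<close> it generates \<open>N/X\<close> because
      \<open>r \<cdot> y\<close> is epi; that it generates alone forces \<open>h\<close> to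
      vanish.\<close>
    let ?c = "Ker C h"
    have c: "?S ?c" by (rule subobject_Ker[OF h(1)])
    have J: "?J ?c"
    proof (intro allI ballI impI, elim conjE)
      fix X g assume g: "g \<in> Hom C ?B X" "(g \<cdot> ?q) \<cdot> y = Zero C (Dom C y) X"
        "g \<cdot> ?c = Zero C (Dom C ?c) X"
      obtain g' where g': "g' \<in> Hom C Z X" "g' \<cdot> h = g"
        using epi_cokernel_of_Ker[OF eh h(1) g(1,3)] by blast
      have "g' \<cdot> (r \<cdot> y) = Zero C (Dom C y) X"
        using Comp_assoc[OF Q(2) h(1) g'(1)] h(2) g'(2) g(2) Comp_assoc[OF yH r g'(1)] by simp
      then have "g' = Zero C Z X" using A epi_iff[OF Comp_Hom[OF yH r]] g'(1) by blast
      then show "g = Zero C ?B X" using g'(2) Zero_Comp[OF Hom_Obj_Cod[OF g'(1)] h(1)] by simp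
    qed
    have "?E ?c" using la c J sf unfolding lies_above_def by blast
    then have "h = Zero C ?B Z" using is_kernelD(3)[OF Ker[OF h(1)] h(1)] h(1) by blast
    then show "r = Zero C N Z" using h(2) Zero_Comp[OF Hom_Obj_Cod[OF h(1)] Q(2)] by simp
  next
    assume R: "sub_le C x y \<and>
      (\<forall>Z. \<forall>r\<in>Hom C N Z. epi_arr C r \<and> r \<cdot> x = Zero C (Dom C x) Z \<and> epi_arr C (r \<cdot> y) \<longrightarrow>
        r = Zero C N Z)"
    have "?E c" if cs: "?S c" and J: "?J c" for c
    proof (intro allI ballI impI)
      fix X g assume g: "g \<in> Hom C ?B X" "g \<cdot> c = Zero C (Dom C c) X"
      note cH = subobject_Hom[OF cs]
      \<comment> \<open>The criterion is applied to \<open>?r\<close>, the projection of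
        \<open>N\<close> onto the quotient of \<open>N/X\<close> by \<open>c\<close>; its vanishing
        says that \<open>c\<close> is all of \<open>N/X\<close>.\<close>
      let ?h = "Coker C c"
      note h = is_cokernelD[OF Coker[OF cH] cH]
      let ?r = "?h \<cdot> ?q"
      note r = Comp_Hom[OF Q(2) h(2)]
      have "epi_arr C (?r \<cdot> y)"
        unfolding epi_iff[OF Comp_Hom[OF yH r]]
      proof (intro allI ballI impI)
        fix W t assume t: "t \<in> Hom C (Cod C ?h) W" "t \<cdot> (?r \<cdot> y) = Zero C (Dom C y) W"
        have "((t \<cdot> ?h) \<cdot> ?q) \<cdot> y = Zero C (Dom C y) W"
          using t(2) Comp_assoc[OF yH r t(1)] Comp_assoc[OF Q(2) h(2) t(1)] by simp
        moreover have "(t \<cdot> ?h) \<cdot> c = Zero C (Dom C c) W"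
          using Comp_assoc[OF cH h(2) t(1)] h(3) Comp_Zero[OF Hom_Obj_Dom[OF cH] t(1)] by simp
        ultimately have "t \<cdot> ?h = Zero C ?B W" using J Comp_Hom[OF h(2) t(1)] by blast
        then show "t = Zero C (Cod C ?h) W" using h(1) epi_iff[OF h(2)] t(1) by blast
      qed
      moreover have "?r \<cdot> x = Zero C (Dom C x) (Cod C ?h)"
        using Comp_assoc[OF xH Q(2) h(2)] Q(3) Comp_Zero[OF Hom_Obj_Dom[OF xH] h(2)] by simp
      moreover have "epi_arr C ?r" by (rule epi_Comp[OF Q(1) h(1) Q(2) h(2)])
      ultimately have "?r = Zero C N (Cod C ?h)" using R r by blast
      then have h0: "?h = Zero C ?B (Cod C ?h)" using Q(1) epi_iff[OF Q(2)] h(2) by blast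
      obtain g' where g': "g' \<in> Hom C (Cod C ?h) X" "g' \<cdot> ?h = g" using h(4)[OF g] by blast
      then show "g = Zero C ?B X" using h0 Comp_Zero[OF Hom_Obj_Cod[OF Q(2)] g'(1)] by metis
    qed
    then show "lies_above C y x" unfolding lies_above_def using sf le by blast
  qed
qed (simp add: lies_above_def)

text \<open>Given a test epimorphism \<open>r\<close> for \<open>d\<close> and \<open>y\<close>,
  compose it with the cokernel of \<open>r \<cdot> k\<close>. The composite annihilates
  \<open>k\<close> and is still epi on \<open>y\<close>, so it vanishes because \<open>y\<close>
  lies above \<open>k\<close>. Hence that cokernel is zero, \<open>r \<cdot> k\<close> is epi, and
  \<open>r\<close> is a test for \<open>d\<close> and \<open>k\<close>.\<close>

lemma lies_above_trans:
  assumes d: "subobject C N d" and k: "subobject C N k" and y: "subobject C N y"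
    and yk: "lies_above C y k" and kd: "lies_above C k d"
  shows "lies_above C y d"
  unfolding lies_above_iff[OF d y]
proof (intro conjI allI ballI impI, goal_cases)
  case 1
  show ?case using yk kd sub_le_trans Hom_Arr[OF subobject_Hom[OF y]] unfolding lies_above_def by blast
next
  case (2 Z r)
  note r = \<open>r \<in> Hom C N Z\<close>
  note kH = subobject_Hom[OF k] and yH = subobject_Hom[OF y]
  note rk = Comp_Hom[OF kH r]
  let ?s = "Coker C (r \<cdot> k)"
  note s = is_cokernelD[OF Coker[OF rk] rk]
  note sr = Comp_Hom[OF r s(2)]
  have "epi_arr C (?s \<cdot> (r \<cdot> y))" using epi_Comp[OF _ s(1) Comp_Hom[OF yH r] s(2)] 2 by blast
  then have "epi_arr C ((?s \<cdot> r) \<cdot> y)" using Comp_assoc[OF yH r s(2)] by simp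
  moreover have "(?s \<cdot> r) \<cdot> k = Zero C (Dom C k) (Cod C ?s)" using Comp_assoc[OF kH r s(2)] s(3) by simp
  moreover have "epi_arr C (?s \<cdot> r)" using epi_Comp[OF _ s(1) r s(2)] 2 by blast
  ultimately have "?s \<cdot> r = Zero C N (Cod C ?s)" using yk[unfolded lies_above_iff[OF k y]] sr by blast
  then have s0: "?s = Zero C Z (Cod C ?s)" using 2 epi_iff[OF r] s(2) by blast
  have "epi_arr C (r \<cdot> k)"
    unfolding epi_iff[OF rk]
  proof (intro allI ballI impI)
    fix X t assume t: "t \<in> Hom C Z X" "t \<cdot> (r \<cdot> k) = Zero C (Dom C k) X"
    obtain t' where "t' \<in> Hom C (Cod C ?s) X" "t' \<cdot> ?s = t" using s(4)[OF t] by blast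
    then show "t = Zero C Z X" using s0 Comp_Zero[OF Hom_Obj_Cod[OF r]] by metis
  qed
  then show "r = Zero C N Z" using kd[unfolded lies_above_iff[OF d k]] 2 by blast
qed

section \<open>Essential monomorphisms\<close>

lemma essential_Comp:
  assumes u: "essential C u" "u \<in> Hom C X K" and v: "essential C v" "v \<in> Hom C K D"
  shows "essential C (v \<cdot> u)"
proof -
  have mu: "mono_arr C u" and mv: "mono_arr C v" using u v unfolding essential_def by blast+
  note vu = Comp_Hom[OF u(2) v(2)]
  have mvu: "mono_arr C (v \<cdot> u)" by (rule mono_Comp[OF mu mv u(2) v(2)])
  have us: "subobject C K u" and vs: "subobject C D v" and vus: "subobject C D (v \<cdot> u)"
    using mu mv mvu Hom_Cod[OF u(2)] Hom_Cod[OF v(2)] Hom_Cod[OF vu] by (auto simp: subobject_def)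
  \<comment> \<open>The intersection of \<open>c\<close> with \<open>v\<close> is viewed inside
    \<open>K\<close> as \<open>w'\<close>. Its intersection \<open>?t\<close> with \<open>u\<close>,
    pushed forward along \<open>v\<close>, lies in both \<open>v \<cdot> u\<close> and
    \<open>c\<close>, hence is zero. Essentiality of \<open>u\<close> then makes \<open>w'\<close>
    zero, and that of \<open>v\<close> makes \<open>c\<close> zero.\<close>
  have "zero_object C (Dom C c)"
    if c: "subobject C D c" and z: "zero_object C (Dom C (sub_inter C D {v \<cdot> u, c}))" for c
  proof -
    let ?w = "sub_inter C D {v, c}"
    have w: "subobject C D ?w" "sub_le C ?w v" "sub_le C ?w c"
      using is_intersection_binary[OF vs c] unfolding is_intersection_def by auto
    obtain w' where w': "w' \<in> Hom C (Dom C ?w) K" "v \<cdot> w' = ?w"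
      using w(2) Hom_Dom[OF v(2)] unfolding sub_le_def by auto
    have w's: "subobject C K w'"
      using mono_factor[OF _ w'(1) v(2)] w'(2) w(1) Hom_Cod[OF w'(1)] unfolding subobject_def by simp
    let ?t = "sub_inter C K {u, w'}"
    have t: "subobject C K ?t" "sub_le C ?t u" "sub_le C ?t w'"
      using is_intersection_binary[OF us w's] unfolding is_intersection_def by auto
    note tH = subobject_Hom[OF t(1)]
    note vt = Comp_Hom[OF tH v(2)]
    have vts: "subobject C D (v \<cdot> ?t)"
      using mono_Comp[OF _ mv tH v(2)] t(1) Hom_Cod[OF vt] unfolding subobject_def by blast
    have lift: "sub_le C (v \<cdot> ?t) (v \<cdot> a)" if a: "a \<in> Hom C A K" "sub_le C ?t a" for a A
    proof -
      obtain b where b: "b \<in> Hom C (Dom C ?t) A" "a \<cdot> b = ?t"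
        using a Hom_Dom[OF a(1)] unfolding sub_le_def by auto
      have "(v \<cdot> a) \<cdot> b = v \<cdot> ?t" using Comp_assoc[OF b(1) a(1) v(2)] b(2) by simp
      then show ?thesis using b(1) Hom_Dom[OF vt] Hom_Dom[OF Comp_Hom[OF a(1) v(2)]]
        unfolding sub_le_def by auto
    qed
    have "sub_le C (v \<cdot> ?t) c"
      using sub_le_trans[OF _ w(3) Hom_Arr[OF subobject_Hom[OF c]]] lift[OF w'(1) t(3)] w'(2) by simp
    then have "sub_le C (v \<cdot> ?t) (sub_inter C D {v \<cdot> u, c})"
      and "subobject C D (sub_inter C D {v \<cdot> u, c})"
      using is_intersection_binary[OF vus c] vts lift[OF u(2) t(2)] unfolding is_intersection_def by auto
    then have "zero_object C (Dom C ?t)" using zero_object_sub_le[OF vts _ _ z] Hom_Dom[OF vt] by simp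
    then have "zero_object C (Dom C w')" using u(1) w's Hom_Cod[OF u(2)] unfolding essential_def by blast
    then show ?thesis
      using v(1) c Hom_Cod[OF v(2)] Hom_Dom[OF w'(1)] unfolding essential_def by auto
  qed
  then show ?thesis using mvu Hom_Cod[OF vu] unfolding essential_def by simp
qed

lemma essential_in_trans:
  assumes d: "subobject C M d" and k: "subobject C M k"
    and xk: "essential_in C x k" and kd: "essential_in C k d"
  shows "essential_in C x d"
proof -
  note dH = subobject_Hom[OF d]
  have le: "sub_le C x k" "sub_le C k d" and ess: "essential C (sub_incl C x k)" "essential C (sub_incl C k d)"
    using xk kd unfolding essential_in_def by blast+
  note u = sub_incl[OF le(1) k] and v = sub_incl[OF le(2) d]
  have xd: "sub_le C x d" by (rule sub_le_trans[OF le Hom_Arr[OF dH]])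
  note w = sub_incl[OF xd d]
  have "sub_incl C x d = sub_incl C k d \<cdot> sub_incl C x k"
    using mono_cancel[OF _ dH w(1) Comp_Hom[OF u(1) v(1)]] d w(2) Comp_assoc[OF u(1) v(1) dH] u(2) v(2)
    unfolding subobject_def by simp
  then show ?thesis using essential_Comp[OF ess(1) u(1) ess(2) v(1)] xd unfolding essential_in_def by simp
qed

section \<open>Intersections of kernels and sums of images over small families\<close>

lemma is_intersection_Ker:
  fixes I :: "'u set"
  assumes "AB3_star TYPE('u) C" "small TYPE('u) I" "M \<in> Obj C" "N \<in> Obj C"
    and f: "\<And>i. i \<in> I \<Longrightarrow> f i \<in> Hom C M N"
  shows "is_intersection C M ((\<lambda>i. Ker C (f i)) ` I) (sub_inter C M ((\<lambda>i. Ker C (f i)) ` I))"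
proof -
  \<comment> \<open>The product of \<open>I\<close> copies of \<open>N\<close>. The morphism
    \<open>\<phi>\<close> with components \<open>f i\<close> annihilates exactly what all
    \<open>f i\<close> annihilate, by uniqueness of morphisms into a product, so its kernel is the
    intersection.\<close>
  obtain P p where P: "is_product C I (\<lambda>_. N) P p"
    using assms(1)[unfolded AB3_star_def, rule_format, of I "\<lambda>_. N"] assms(2,4) by blast
  then have PO: "P \<in> Obj C" and p: "\<And>i. i \<in> I \<Longrightarrow> p i \<in> Hom C P N"
    unfolding is_product_def by blast+
  have U: "\<exists>!h. h \<in> Hom C X P \<and> (\<forall>i\<in>I. p i \<cdot> h = g i)"
    if "X \<in> Obj C" "\<forall>i\<in>I. g i \<in> Hom C X N" for X g
    using P that unfolding is_product_def by blast
  obtain \<phi> where \<phi>: "\<phi> \<in> Hom C M P" "\<And>i. i \<in> I \<Longrightarrow> p i \<cdot> \<phi> = f i"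
    using U[OF assms(3), of f] f by blast
  have "\<phi> \<cdot> l = Zero C X P \<longleftrightarrow> (\<forall>i\<in>I. f i \<cdot> l = Zero C X N)" if l: "l \<in> Hom C X M" for l X
  proof
    note X = Hom_Obj_Dom[OF l]
    assume "\<phi> \<cdot> l = Zero C X P"
    then show "\<forall>i\<in>I. f i \<cdot> l = Zero C X N"
      using Comp_assoc[OF l \<phi>(1) p] \<phi>(2) Comp_Zero[OF X p] by auto
  next
    note X = Hom_Obj_Dom[OF l]
    assume "\<forall>i\<in>I. f i \<cdot> l = Zero C X N"
    then have "\<forall>i\<in>I. p i \<cdot> (\<phi> \<cdot> l) = Zero C X N" using Comp_assoc[OF l \<phi>(1) p] \<phi>(2) by auto
    moreover have "\<forall>i\<in>I. p i \<cdot> Zero C X P = Zero C X N" using Comp_Zero[OF X p] by blast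
    ultimately show "\<phi> \<cdot> l = Zero C X P"
      using U[OF X, of "\<lambda>_. Zero C X N"] Zero_Hom[OF X] assms(4) PO Comp_Hom[OF l \<phi>(1)] by blast
  qed
  then have *: "sub_le C l (Ker C \<phi>) \<longleftrightarrow> (\<forall>i\<in>I. sub_le C l (Ker C (f i)))" if "subobject C M l" for l
    using sub_le_Ker_iff[OF \<phi>(1) subobject_Hom[OF that]] sub_le_Ker_iff[OF f subobject_Hom[OF that]]
      subobject_Hom[OF that] by simp
  note K = subobject_Ker[OF \<phi>(1)]
  have "sub_le C (Ker C \<phi>) (Ker C \<phi>)"
    using sub_le_Ker_iff[OF \<phi>(1) subobject_Hom[OF K]] is_kernelD(3)[OF Ker[OF \<phi>(1)] \<phi>(1)] by simp
  then have "is_intersection C M ((\<lambda>i. Ker C (f i)) ` I) (Ker C \<phi>)"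
    using * K unfolding is_intersection_def by blast
  then show ?thesis unfolding sub_inter_def by (rule someI)
qed

text \<open>The \<open>f i\<close> assemble into one morphism out of a coproduct of copies of
  \<open>M\<close>. It is annihilated exactly by the morphisms that annihilate every
  \<open>f i\<close>, equivalently every image, so its own image is the sum.\<close>

lemma is_sum_Img_family:
  fixes I :: "'u set"
  assumes "AB3 TYPE('u) C" "small TYPE('u) I" "M \<in> Obj C" "N \<in> Obj C"
    and f: "\<And>i. i \<in> I \<Longrightarrow> f i \<in> Hom C M N"
  shows "is_sum C N ((\<lambda>i. Img C (f i)) ` I) (sub_sum C N ((\<lambda>i. Img C (f i)) ` I))"
proof -
  obtain P j where P: "is_coproduct C I (\<lambda>_. M) P j"
    using assms(1)[unfolded AB3_def, rule_format, of I "\<lambda>_. M"] assms(2,3) by blast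
  then have PO: "P \<in> Obj C" and j: "\<And>i. i \<in> I \<Longrightarrow> j i \<in> Hom C M P"
    unfolding is_coproduct_def by blast+
  have U: "\<exists>!h. h \<in> Hom C P X \<and> (\<forall>i\<in>I. h \<cdot> j i = g i)"
    if "X \<in> Obj C" "\<forall>i\<in>I. g i \<in> Hom C M X" for X g
    using P that unfolding is_coproduct_def by blast
  obtain \<phi> where \<phi>: "\<phi> \<in> Hom C P N" "\<And>i. i \<in> I \<Longrightarrow> \<phi> \<cdot> j i = f i"
    using U[OF assms(4), of f] f by blast
  have "g \<cdot> \<phi> = Zero C P X \<longleftrightarrow> (\<forall>i\<in>I. g \<cdot> f i = Zero C M X)" if g: "g \<in> Hom C N X" for g X
  proof
    note X = Hom_Obj_Cod[OF g]
    assume "g \<cdot> \<phi> = Zero C P X"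
    then show "\<forall>i\<in>I. g \<cdot> f i = Zero C M X"
      using Comp_assoc[OF j \<phi>(1) g] \<phi>(2) Zero_Comp[OF X j] by auto
  next
    note X = Hom_Obj_Cod[OF g]
    assume "\<forall>i\<in>I. g \<cdot> f i = Zero C M X"
    then have "\<forall>i\<in>I. (g \<cdot> \<phi>) \<cdot> j i = Zero C M X" using Comp_assoc[OF j \<phi>(1) g] \<phi>(2) by auto
    moreover have "\<forall>i\<in>I. Zero C P X \<cdot> j i = Zero C M X" using Zero_Comp[OF X j] by blast
    ultimately show "g \<cdot> \<phi> = Zero C P X"
      using U[OF X, of "\<lambda>_. Zero C M X"] Zero_Hom[OF _ X] assms(3) PO Comp_Hom[OF \<phi>(1) g] by blast
  qed
  then have "is_sum C N ((\<lambda>i. Img C (f i)) ` I) (Img C \<phi>)"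
    using Comp_Img_Zero_iff[OF f] Img_Hom(1)[OF f] by (intro is_sum_Img[OF \<phi>(1)]) auto
  then show ?thesis unfolding sub_sum_def by (rule someI)
qed

end

text \<open>The Baer conditions range over index sets of type \<open>'u set\<close>, whereas an
  annihilator is a set of morphisms. The cardinality bound gives an injection of \<open>S\<close>
  into \<open>'u\<close>; its image serves as index set and its inverse as the family.\<close>

lemma small_family:
  assumes "small TYPE('u) H" "S \<subseteq> H"
  obtains I :: "'u set" and f where "small TYPE('u) I" "f ` I = S"
proof -
  have "|S| <o |UNIV :: 'u set|"
    using assms card_of_mono1[OF assms(2)] ordLeq_ordLess_trans unfolding small_def by blast
  moreover from this obtain g :: "'a \<Rightarrow> 'u" where "inj_on g S"
    using card_of_ordLeq[of S "UNIV :: 'u set"] ordLess_imp_ordLeq by blast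
  ultimately show thesis
    using card_of_image[of g S] ordLeq_ordLess_trans
    by (intro that[of "g ` S" "inv_into S g"]) (auto simp: small_def image_image)
qed

section \<open>From annihilators to summands\<close>

context abelian_category
begin

text \<open>\<open>P\<close> stands for the extra demand on the summand, either trivial or full
  invariance, so the plain and strong versions share one proof: the summand is the one supplied for
  \<open>?K\<close>, and \<open>P\<close> is passed on unchanged.\<close>

lemma essential_in_summand:
  assumes "AB3_star TYPE('u) C" "locally_small TYPE('u) C" "M \<in> Obj C" "N \<in> Obj C"
    and EK: "EK_cononsingular C M N" and x: "subobject C M x"
    and Baer: "\<And>(I :: 'u set) f. small TYPE('u) I \<Longrightarrow> \<forall>i\<in>I. f i \<in> Hom C M N \<Longrightarrow>
      \<exists>d. direct_summand C M d \<and> P d \<and> essential_in C (sub_inter C M ((\<lambda>i. Ker C (f i)) ` I)) d"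
  shows "\<exists>d. direct_summand C M d \<and> P d \<and> essential_in C x d"
proof -
  have "small TYPE('u) (Hom C M N)" "l_ann C M N x \<subseteq> Hom C M N"
    using assms(2-4) unfolding locally_small_def l_ann_def by auto
  then obtain I :: "'u set" and f where I: "small TYPE('u) I" and fI: "f ` I = l_ann C M N x"
    by (rule small_family)
  have f: "f i \<in> Hom C M N" and xf: "sub_le C x (Ker C (f i))" if "i \<in> I" for i
    using fI that unfolding l_ann_def by blast+
  let ?K = "sub_inter C M ((\<lambda>i. Ker C (f i)) ` I)"
  have int: "is_intersection C M ((\<lambda>i. Ker C (f i)) ` I) ?K"
    by (rule is_intersection_Ker[OF assms(1) I assms(3,4) f])
  then have K: "subobject C M ?K" "sub_le C x ?K"
    using x xf unfolding is_intersection_def by auto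
  \<comment> \<open>The \<open>f i\<close> exhaust the annihilator of \<open>x\<close>, and each
    annihilates \<open>?K\<close> by construction; the other inclusion follows from \<open>x\<close>
    being contained in \<open>?K\<close>.\<close>
  have "l_ann C M N x = l_ann C M N ?K"
  proof
    have "f i \<in> l_ann C M N ?K" if "i \<in> I" for i
      using int f that unfolding is_intersection_def l_ann_def by blast
    then show "l_ann C M N x \<subseteq> l_ann C M N ?K" unfolding fI[symmetric] by blast
    show "l_ann C M N ?K \<subseteq> l_ann C M N x"
      using sub_le_trans[OF K(2)] Hom_Arr[OF subobject_Hom[OF subobject_Ker]] unfolding l_ann_def by blast
  qed
  then have xK: "essential_in C x ?K" using EK x K unfolding EK_cononsingular_def by blast
  obtain d where "direct_summand C M d" "P d" "essential_in C ?K d" using Baer[OF I] f by blast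
  then show ?thesis
    using essential_in_trans[OF _ K(1) xK] unfolding direct_summand_def by blast
qed

text \<open>Here \<open>?K\<close> is the part of \<open>y\<close> generated by morphisms from
  \<open>M\<close>: it is contained in \<open>y\<close>, yet every morphism with image in
  \<open>y\<close> already has its image in \<open>?K\<close>. Cononsingularity turns this into
  \<open>y\<close> lying above \<open>?K\<close>. \<open>P\<close> is as in
  \<open>essential_in_summand\<close>.\<close>

lemma lies_above_summand:
  assumes "AB3 TYPE('u) C" "locally_small TYPE('u) C" "M \<in> Obj C" "N \<in> Obj C"
    and LT: "LT_cononsingular C M N" and y: "subobject C N y"
    and Baer: "\<And>(I :: 'u set) f. small TYPE('u) I \<Longrightarrow> \<forall>i\<in>I. f i \<in> Hom C M N \<Longrightarrow>
      \<exists>d. direct_summand C N d \<and> P d \<and> lies_above C (sub_sum C N ((\<lambda>i. Img C (f i)) ` I)) d"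
  shows "\<exists>d. direct_summand C N d \<and> P d \<and> lies_above C y d"
proof -
  have "small TYPE('u) (Hom C M N)" "l_ann' C M N y \<subseteq> Hom C M N"
    using assms(2-4) unfolding locally_small_def l_ann'_def by auto
  then obtain I :: "'u set" and f where I: "small TYPE('u) I" and fI: "f ` I = l_ann' C M N y"
    by (rule small_family)
  have f: "f i \<in> Hom C M N" and fy: "sub_le C (Img C (f i)) y" if "i \<in> I" for i
    using fI that unfolding l_ann'_def by blast+
  let ?K = "sub_sum C N ((\<lambda>i. Img C (f i)) ` I)"
  have sum: "is_sum C N ((\<lambda>i. Img C (f i)) ` I) ?K"
    by (rule is_sum_Img_family[OF assms(1) I assms(3,4) f])
  then have K: "subobject C N ?K" "sub_le C ?K y"
    using y fy unfolding is_sum_def by auto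
  have "l_ann' C M N ?K = l_ann' C M N y"
  proof
    have "f i \<in> l_ann' C M N ?K" if "i \<in> I" for i
      using sum f that unfolding is_sum_def l_ann'_def by blast
    then show "l_ann' C M N y \<subseteq> l_ann' C M N ?K" unfolding fI[symmetric] by blast
    show "l_ann' C M N ?K \<subseteq> l_ann' C M N y"
      using sub_le_trans[OF _ K(2)] Hom_Arr[OF subobject_Hom[OF y]] unfolding l_ann'_def by blast
  qed
  then have yK: "lies_above C y ?K" using LT y K unfolding LT_cononsingular_def by blast
  obtain d where "direct_summand C N d" "P d" "lies_above C ?K d" using Baer[OF I] f by blast
  then show ?thesis
    using lies_above_trans[OF _ K(1) y yK] unfolding direct_summand_def by blast
qed

end

theorem theorem5p4:
  fixes C :: "('o, 'm) precat" and M N :: 'o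
  assumes "abelian_category C" and "locally_small TYPE('u) C"
    and "M \<in> Obj C" and "N \<in> Obj C"
  shows
    "(AB3_star TYPE('u) C \<longrightarrow>
        (CS_Baer TYPE('u) C M N \<and> EK_cononsingular C M N \<longrightarrow> extending C M) \<and>
        (strongly_CS_Baer TYPE('u) C M N \<and> EK_cononsingular C M N \<longrightarrow> strongly_extending C M)) \<and>
     (AB3 TYPE('u) C \<longrightarrow>
        (dual_CS_Baer TYPE('u) C M N \<and> LT_cononsingular C M N \<longrightarrow> lifting C N) \<and>
        (dual_strongly_CS_Baer TYPE('u) C M N \<and> LT_cononsingular C M N \<longrightarrow> strongly_lifting C N))"
proof -
  interpret abelian_category C by (rule assms(1))
  show ?thesis
  proof (intro conjI impI; elim conjE)
    assume A: "AB3_star TYPE('u) C" "CS_Baer TYPE('u) C M N" "EK_cononsingular C M N"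
    then show "extending C M"
      using essential_in_summand[OF A(1) assms(2-4) A(3), where P = "\<lambda>_. True"]
      unfolding extending_def CS_Baer_def by simp
  next
    assume A: "AB3_star TYPE('u) C" "strongly_CS_Baer TYPE('u) C M N" "EK_cononsingular C M N"
    then show "strongly_extending C M"
      using essential_in_summand[OF A(1) assms(2-4) A(3), where P = "fully_invariant C M"]
      unfolding strongly_extending_def strongly_CS_Baer_def by simp
  next
    assume A: "AB3 TYPE('u) C" "dual_CS_Baer TYPE('u) C M N" "LT_cononsingular C M N"
    then show "lifting C N"
      using lies_above_summand[OF A(1) assms(2-4) A(3), where P = "\<lambda>_. True"]
      unfolding lifting_def dual_CS_Baer_def by simp
  next
    assume A: "AB3 TYPE('u) C" "dual_strongly_CS_Baer TYPE('u) C M N" "LT_cononsingular C M N"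
    then show "strongly_lifting C N"
      using lies_above_summand[OF A(1) assms(2-4) A(3), where P = "fully_invariant C N"]
      unfolding strongly_lifting_def dual_strongly_CS_Baer_def by simp
  qed
qed

end
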